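(* Let $n\ge 2$, let $\mathcal{G}$ be a connected weighted undirected graph on $n$ vertices with Laplacian matrix $L$, let $\lambda_2$ be the minimum non-zero eigenvalue of $L$, and let $\alpha,\beta>0$ be real constants. Let $T_2(s)$ be the transfer matrix from $\omega$ to $y$ of the closed-loop multi-agent system with the relative velocity protocol $$\begin{bmatrix} \dot x(t) \\ \dot v(t) \end{bmatrix}=\begin{bmatrix} \mathbf{0} & I_n \\ -\alpha L & -\beta L \end{bmatrix}\begin{bmatrix} x(t) \\ v(t) \end{bmatrix}+\begin{bmatrix} \mathbf{0} \\ I_n \end{bmatrix}\omega(t),\qquad y(t)=\begin{bmatrix} \Phi_n & \mathbf{0} \\ \mathbf{0} & \Phi_n \end{bmatrix}\begin{bmatrix} x(t) \\ v(t) \end{bmatrix},$$ where $\Phi_n=I_n-\frac1n\mathbf{1}_n\mathbf{1}_n^{\top}$. Then $$\|T_2(s)\|_\infty=\begin{cases} \dfrac{1}{\sqrt{(\alpha\lambda_2)^2-\Big[\sqrt{(\alpha\lambda_2+1)^2-(\beta\lambda_2)^2}-1\Big]^2}}, & \text{if } 0<\beta<\sqrt{\alpha^2+\dfrac{2\alpha}{\lambda_2}}, \\[3ex] \dfrac{1}{\alpha\lambda_2}, & \text{if } \beta\ge\sqrt{\alpha^2+\dfrac{2\alpha}{\lambda_2}}. \end{cases}$$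
   Context: Graph: a weighted undirected graph on vertices $1,\dots,n$ is given by a symmetric weighted adjacency matrix $\mathcal{A}=[a_{ij}]\in\mathbb{R}^{n\times n}$ with $a_{ij}=a_{ji}\ge 0$ and $a_{ii}=0$; there is an edge between $i$ and $j$ iff $a_{ij}>0$. It is connected if any two distinct vertices are joined by a path. The Laplacian $L=[l_{ij}]$ has $l_{ii}=\sum_{j\ne i}a_{ij}$ and $l_{ij}=-a_{ij}$ for $j\neq i$. For a connected graph the eigenvalues of $L$ are $0=\lambda_1<\lambda_2\le\cdots\le\lambda_n$. System: the agents satisfy $\dot x_i=v_i$, $\dot v_i=u_i+\omega_i$ ($i=1,\dots,n$), with disturbance $\omega_i\in\mathcal{L}_2[0,\infty)$ and relative velocity protocol $u_i=\alpha\sum_{j=1}^n a_{ij}(x_j-x_i)+\beta\sum_{j=1}^n a_{ij}(v_j-v_i)$. The output $y$ stacks the consensus errors $x_i-\frac1n\sum_j x_j$ and $v_i-\frac1n\sum_j v_j$. This gives the displayed system with $x=[x_1,\dots,x_n]^\top$, $v=[v_1,\dots,v_n]^\top$, $\omega=[\omega_1,\dots,\omega_n]^\top$. Here $\mathbf{1}_n$ is the all-ones column vector and $I_n$ the identity matrix. Transfer matrix and norm: for a system $\dot z=Az+B\omega$, $y=Cz$, the transfer matrix is the matrix of rational functions $T(s)=C(sI-A)^{-1}B$ (common factors cancelled; the modes of $A$ along the consensus direction, which are not asymptotically stable, are unobservable from $y$ and so contribute no poles to $T$). Its $H_\infty$ norm is $\|T(s)\|_\infty=\sup_{\upsilon\in\mathbb{R}}\sigma_{\max}[T(\mathbf{j}\upsilon)]$,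 where $\mathbf{j}$ is the imaginary unit and $\sigma_{\max}$ is the maximum singular value. *)

theory Defs
  imports
    "HOL-Library.Extended_Real"
    "HOL-Computational_Algebra.Computational_Algebra"
    "HOL-Computational_Algebra.Field_as_Ring"
    "Jordan_Normal_Form.Gauss_Jordan_Elimination"
    "Jordan_Normal_Form.Char_Poly"
    "Jordan_Normal_Form.Schur_Decomposition"
begin

section \<open>Weighted undirected graphs\<close>

text \<open>The vertices are \<open>0, \<dots>, n - 1\<close>.\<close>

definition weighted_graph :: "nat \<Rightarrow> real mat \<Rightarrow> bool" where
  "weighted_graph n A \<longleftrightarrow> A \<in> carrier_mat n n \<and>
     (\<forall>i<n. \<forall>j<n. A $$ (i, j) = A $$ (j, i) \<and> 0 \<le> A $$ (i, j)) \<and>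
     (\<forall>i<n. A $$ (i, i) = 0)"

definition edges :: "nat \<Rightarrow> real mat \<Rightarrow> (nat \<times> nat) set" where
  "edges n A = {(i, j). i < n \<and> j < n \<and> 0 < A $$ (i, j)}"

definition connected_graph :: "nat \<Rightarrow> real mat \<Rightarrow> bool" where
  "connected_graph n A \<longleftrightarrow> (\<forall>i<n. \<forall>j<n. i \<noteq> j \<longrightarrow> (i, j) \<in> (edges n A)\<^sup>*)"

definition laplacian :: "nat \<Rightarrow> real mat \<Rightarrow> real mat" where
  "laplacian n A = mat n n (\<lambda>(i, j).
     if i = j then (\<Sum>k\<in>{0..<n} - {i}. A $$ (i, k)) else - A $$ (i, j))"

definition min_nonzero_eigenvalue :: "real mat \<Rightarrow> real" where
  "min_nonzero_eigenvalue L = Min {k. eigenvalue L k \<and> k \<noteq> 0}"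


section \<open>Transfer matrices and the H-infinity norm\<close>

text \<open>Rational functions are elements of the fraction field of \<open>complex poly\<close>; the
  indeterminate \<open>s\<close> is the polynomial \<open>[:0, 1:]\<close>.\<close>

definition const_mat :: "real mat \<Rightarrow> complex poly fract mat" where
  "const_mat M = map_mat (\<lambda>a. to_fract [:complex_of_real a:]) M"

text \<open>For a square matrix \<open>A\<close> the matrix \<open>s I - A\<close> is invertible over the field of rational
  functions, so \<open>mat_inverse\<close> returns a proper value.\<close>

definition transfer_matrix ::
    "real mat \<Rightarrow> real mat \<Rightarrow> real mat \<Rightarrow> complex poly fract mat" where
  "transfer_matrix A B C =
     const_mat C *
     the (mat_inverse (to_fract [:0, 1:] \<cdot>\<^sub>m 1\<^sub>m (dim_row A) - const_mat A)) *
     const_mat B"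

text \<open>The function \<open>quot_of_fract\<close> yields the coprime numerator and denominator, so poles and
  values are those of the rational function after cancellation of common factors.\<close>

definition fract_pole :: "complex poly fract \<Rightarrow> complex \<Rightarrow> bool" where
  "fract_pole r z \<longleftrightarrow> poly (snd (quot_of_fract r)) z = 0"

definition fract_eval :: "complex poly fract \<Rightarrow> complex \<Rightarrow> complex" where
  "fract_eval r z = poly (fst (quot_of_fract r)) z / poly (snd (quot_of_fract r)) z"

definition singular_values :: "complex mat \<Rightarrow> real set" where
  "singular_values M =
     {\<sigma>. 0 \<le> \<sigma> \<and> eigenvalue (mat_adjoint M * M) (complex_of_real (\<sigma>\<^sup>2))}"

definition sigma_max :: "complex mat \<Rightarrow> real" where
  "sigma_max M = Max (singular_values M)"

text \<open>The norm is an extended real: it is \<open>\<infinity>\<close> if \<open>T\<close> is unbounded on the imaginary axis, and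
  a frequency at which some entry of \<open>T\<close> has a pole contributes \<open>\<infinity>\<close> to the supremum.\<close>

definition hinf_norm :: "complex poly fract mat \<Rightarrow> ereal" where
  "hinf_norm T = (SUP \<upsilon>::real.
     if \<exists>i<dim_row T. \<exists>j<dim_col T. fract_pole (T $$ (i, j)) (\<i> * complex_of_real \<upsilon>)
     then \<infinity>
     else ereal (sigma_max (map_mat (\<lambda>r. fract_eval r (\<i> * complex_of_real \<upsilon>)) T)))"


section \<open>The closed loop of the relative velocity protocol\<close>

definition ones :: "nat \<Rightarrow> real mat" where
  "ones n = mat n 1 (\<lambda>_. 1)"

definition Phi :: "nat \<Rightarrow> real mat" where
  "Phi n = 1\<^sub>m n - (1 / real n) \<cdot>\<^sub>m (ones n * transpose_mat (ones n))"

definition state_mat :: "nat \<Rightarrow> real mat \<Rightarrow> real \<Rightarrow> real \<Rightarrow> real mat" where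
  "state_mat n L \<alpha> \<beta> =
     four_block_mat (0\<^sub>m n n) (1\<^sub>m n) ((- \<alpha>) \<cdot>\<^sub>m L) ((- \<beta>) \<cdot>\<^sub>m L)"

definition input_mat :: "nat \<Rightarrow> real mat" where
  "input_mat n = 0\<^sub>m n n @\<^sub>r 1\<^sub>m n"

definition output_mat :: "nat \<Rightarrow> real mat" where
  "output_mat n = four_block_mat (Phi n) (0\<^sub>m n n) (0\<^sub>m n n) (Phi n)"

definition T2 :: "nat \<Rightarrow> real mat \<Rightarrow> real \<Rightarrow> real \<Rightarrow> complex poly fract mat" where
  "T2 n L \<alpha> \<beta> = transfer_matrix (state_mat n L \<alpha> \<beta>) (input_mat n) (output_mat n)"

end

theory Submission
  imports Defs "Jordan_Normal_Form.Spectral_Radius"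
begin

text \<open>Diagonalising the Laplacian by an orthogonal matrix decouples the closed loop into the
  modes \<open>1 / (s\<^sup>2 + (\<beta>s + \<alpha>)\<lambda>)\<close>. As the graph is connected, the output projection removes exactly
  the modes with \<open>\<lambda> = 0\<close>; the others have no pole on the imaginary axis. Hence the squared singular
  values of the transfer matrix at \<open>\<i>\<upsilon>\<close> are \<open>0\<close> and
  \<open>(1 + \<upsilon>\<^sup>2) / ((\<alpha>\<lambda> - \<upsilon>\<^sup>2)\<^sup>2 + (\<beta>\<lambda>\<upsilon>)\<^sup>2)\<close> for the eigenvalues \<open>\<lambda> > 0\<close>. The supremum over \<open>\<upsilon>\<close>
  decreases with \<open>\<lambda>\<close>, so the smallest positive eigenvalue determines the norm.\<close>

text \<open>The resolvent has a double pole at 0 along the consensus direction, and only reduced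
  fractions have values. Nothing may therefore be evaluated early: the real diagonalisation is
  carried into the field of rational functions by the embedding of constants, the output projection
  cancels the zero modes there, and only the product is evaluated on the imaginary axis. At a fixed
  frequency the gain is not monotone in the eigenvalue, since the resonance moves with it. Only
  suprema over all frequencies compare, so two modes have to be compared at different frequencies.
  The threshold on \<beta> marks where the worst frequency leaves 0: from it upwards the norm is the
  static gain, below it the gain peaks at a positive frequency.\<close>

section \<open>The spectral theorem for real symmetric matrices\<close>

text \<open>\<open>H\<close> is the reflection I - c w w^T with w = v - e_0, which exchanges e_0 and
  \<open>v\<close>. It supplies an orthogonal matrix with prescribed column 0 that is its own
  transpose and inverse, as needed for deflation.\<close>

lemma householder:
  fixes v :: "real vec"
  assumes v: "v \<in> carrier_vec (Suc n)" and unit: "v \<bullet> v = 1"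
  obtains H where "H \<in> carrier_mat (Suc n) (Suc n)" "transpose_mat H = H"
    "H * H = 1\<^sub>m (Suc n)" "col H 0 = v"
proof -
  define N where "N = Suc n"
  define w where "w = (\<lambda>i. v $ i - (if i = 0 then 1 else 0))"
  \<comment> \<open>This is 2 / (w . w), because w . w = 2 (1 - v_0) for a unit vector. If v = e_0,
    the convention 1 / 0 = 0 makes \<open>H\<close> the identity, which is the right matrix
    there.\<close>
  define c where "c = 1 / (1 - v $ 0)"
  define \<delta> :: "nat \<Rightarrow> nat \<Rightarrow> real" where "\<delta> = (\<lambda>i j. if i = j then 1 else 0)"
  define H where "H = mat N N (\<lambda>(i, j). \<delta> i j - c * w i * w j)"
  have H: "H \<in> carrier_mat N N" by (simp add: H_def)
  have sq: "(\<Sum>i<N. (v $ i)\<^sup>2) = 1"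
    using unit v by (simp add: scalar_prod_def N_def power2_eq_square atLeast0LessThan)
  have split: "(\<Sum>i<N. f i) = f 0 + (\<Sum>i<n. f (Suc i))" for f :: "nat \<Rightarrow> real"
    unfolding N_def by (rule sum.lessThan_Suc_shift)
  have ww: "(\<Sum>i<N. (w i)\<^sup>2) = 2 * (1 - v $ 0)"
  proof -
    have "(\<Sum>i<N. (w i)\<^sup>2) = (\<Sum>i<N. (v $ i)\<^sup>2) - 2 * v $ 0 + 1"
      unfolding split by (simp add: w_def power2_eq_square algebra_simps)
    then show ?thesis using sq by simp
  qed
  have w0: "w i = 0" if "v $ 0 = 1" "i < N" for i
  proof -
    have "(\<Sum>i<N. (w i)\<^sup>2) = 0" using ww that by simp
    then have "(w i)\<^sup>2 = 0"
      using sum_nonneg_eq_0_iff[of "{..<N}" "\<lambda>i. (w i)\<^sup>2"] that(2) by simp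
    then show ?thesis by simp
  qed
  have cw: "c * (c * (\<Sum>i<N. (w i)\<^sup>2)) = 2 * c"
  proof -
    have "1 / t * (1 / t * (2 * t)) = 2 * (1 / t)" for t :: real
      by (cases "t = 0") auto
    then show ?thesis unfolding ww c_def .
  qed
  have tr: "transpose_mat H = H"
    by (rule eq_matI) (auto simp: H_def \<delta>_def algebra_simps)
  have "H * H = 1\<^sub>m N"
  proof (rule eq_matI)
    fix i j assume "i < dim_row (1\<^sub>m N)" "j < dim_col (1\<^sub>m N)"
    then have ij: "i < N" "j < N" by auto
    have "(H * H) $$ (i, j) = (\<Sum>k<N. (\<delta> i k - c * w i * w k) * (\<delta> k j - c * w k * w j))"
      using ij by (simp add: H_def scalar_prod_def atLeast0LessThan)
    also have "\<dots> = (\<Sum>k<N. \<delta> i k * \<delta> k j - c * w j * (\<delta> i k * w k) - c * w i * (\<delta> k j * w k)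
        + c * c * w i * w j * (w k)\<^sup>2)"
      by (rule sum.cong) (auto simp: algebra_simps power2_eq_square)
    also have "\<dots> = (\<Sum>k<N. \<delta> i k * \<delta> k j) - c * w j * (\<Sum>k<N. \<delta> i k * w k)
        - c * w i * (\<Sum>k<N. \<delta> k j * w k) + c * c * w i * w j * (\<Sum>k<N. (w k)\<^sup>2)"
      by (simp only: sum.distrib sum_subtractf sum_distrib_left)
    also have "(\<Sum>k<N. \<delta> i k * \<delta> k j) = \<delta> i j"
      using ij by (simp add: \<delta>_def if_distrib[of "\<lambda>x. x * _"] cong: if_cong)
    also have "(\<Sum>k<N. \<delta> i k * w k) = w i"
      using ij by (simp add: \<delta>_def if_distrib[of "\<lambda>x. x * _"] cong: if_cong)
    also have "(\<Sum>k<N. \<delta> k j * w k) = w j"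
      using ij by (simp add: \<delta>_def if_distrib[of "\<lambda>x. x * _"] cong: if_cong)
    also have "\<delta> i j - c * w j * w i - c * w i * w j + c * c * w i * w j * (\<Sum>k<N. (w k)\<^sup>2) =
        \<delta> i j + w i * w j * (c * (c * (\<Sum>k<N. (w k)\<^sup>2)) - 2 * c)"
      by (simp add: algebra_simps)
    finally show "(H * H) $$ (i, j) = 1\<^sub>m N $$ (i, j)"
      using ij by (simp add: cw \<delta>_def)
  qed (use H in auto)
  moreover have "col H 0 = v"
  proof (rule eq_vecI)
    fix i assume "i < dim_vec v"
    then have i: "i < N" using v by (simp add: N_def)
    have "H $$ (i, 0) = \<delta> i 0 - c * w 0 * w i"
      using i by (simp add: H_def N_def)
    also have "\<dots> = v $ i"
    proof (cases "v $ 0 = 1")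
      case True
      then show ?thesis using w0[OF True i] by (simp add: w_def \<delta>_def)
    next
      case False
      then have "c * w 0 = - 1" by (simp add: c_def w_def field_simps)
      then show ?thesis by (simp add: w_def \<delta>_def)
    qed
    finally show "col H 0 $ i = v $ i" using i H by simp
  qed (use H v in \<open>auto simp: N_def\<close>)
  ultimately show thesis using that[of H] H tr by (simp add: N_def)
qed

text \<open>A complex eigenvalue \<open>e\<close> exists. The form q = v^* A v equals its own
  conjugate by symmetry, and it equals \<open>e\<close> times the positive number |v|^2, so
  \<open>e\<close> is real.\<close>

lemma symmetric_real_eigenvalue:
  fixes A :: "real mat"
  assumes A: "A \<in> carrier_mat n n" and n: "n > 0" and sym: "transpose_mat A = A"
  obtains k where "eigenvalue A k"
proof -
  let ?A = "map_mat complex_of_real A"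
  have A': "?A \<in> carrier_mat n n" using A by simp
  have symA: "A $$ (i, j) = A $$ (j, i)" if "i < n" "j < n" for i j
    using sym A that by (metis carrier_matD index_transpose_mat(1))
  obtain e where "eigenvalue ?A e"
    using spectrum_non_empty[OF A' n] by (auto simp: spectrum_def)
  then obtain v where v: "v \<in> carrier_vec n" "v \<noteq> 0\<^sub>v n" and ev: "?A *\<^sub>v v = e \<cdot>\<^sub>v v"
    using A' by (auto simp: eigenvalue_def eigenvector_def)
  have ev': "(\<Sum>j<n. of_real (A $$ (i, j)) * v $ j) = e * v $ i" if "i < n" for i
  proof -
    have "(?A *\<^sub>v v) $ i = (e \<cdot>\<^sub>v v) $ i" using ev by simp
    then show ?thesis using that A v by (simp add: scalar_prod_def atLeast0LessThan)
  qed
  define s where "s = (\<Sum>i<n. (cmod (v $ i))\<^sup>2)"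
  define q where "q = (\<Sum>i<n. cnj (v $ i) * (\<Sum>j<n. of_real (A $$ (i, j)) * v $ j))"
  have "q = (\<Sum>i<n. cnj (v $ i) * (e * v $ i))"
    unfolding q_def by (rule sum.cong) (simp_all add: ev')
  then have q: "q = e * of_real s"
    unfolding s_def of_real_sum complex_norm_square sum_distrib_left[of e] by (simp add: mult_ac)
  have "cnj q = (\<Sum>i<n. \<Sum>j<n. v $ i * (of_real (A $$ (i, j)) * cnj (v $ j)))"
    by (simp add: q_def sum_distrib_left)
  also have "\<dots> = (\<Sum>i<n. \<Sum>j<n. v $ j * (of_real (A $$ (j, i)) * cnj (v $ i)))"
    by (rule sum.swap)
  also have "\<dots> = q"
    unfolding q_def sum_distrib_left
    by (intro sum.cong refl) (simp add: symA mult_ac)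
  finally have "cnj q = q" .
  moreover have "s \<noteq> 0"
  proof
    assume "s = 0"
    then have "\<forall>i<n. v $ i = 0"
      unfolding s_def by (subst (asm) sum_nonneg_eq_0_iff) auto
    then have "v = 0\<^sub>v n" using v by (intro eq_vecI) auto
    then show False using v by simp
  qed
  ultimately have "cnj e = e" by (simp add: q)
  then obtain k where k: "e = of_real k" by (metis Reals_cases Reals_cnj_iff)
  \<comment> \<open>The eigenvector found may be complex, so the eigenvalue returns to the real
    matrix as a root of the characteristic polynomial.\<close>
  have "poly (char_poly ?A) e = 0"
    using \<open>eigenvalue ?A e\<close> eigenvalue_root_char_poly[OF A'] by simp
  then have "poly (char_poly A) k = 0"
    by (simp add: of_real_hom.char_poly_hom[OF A] k of_real_hom.poly_map_poly)
  then show thesis using that eigenvalue_root_char_poly[OF A] by simp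
qed

definition orthogonal_matrix :: "nat \<Rightarrow> 'a :: semiring_1 mat \<Rightarrow> bool" where
  "orthogonal_matrix n Q \<longleftrightarrow> Q \<in> carrier_mat n n \<and>
     transpose_mat Q * Q = 1\<^sub>m n \<and> Q * transpose_mat Q = 1\<^sub>m n"

text \<open>The functional calculus in a fixed orthonormal basis: sums, products and multiples of
  such matrices act pointwise on \<open>f\<close>. The type is general because the same basis is
  used over the reals, the complex numbers and the rational functions.\<close>

definition spectral_mat :: "nat \<Rightarrow> 'a :: semiring_1 mat \<Rightarrow> (nat \<Rightarrow> 'a) \<Rightarrow> 'a mat" where
  "spectral_mat n Q f = Q * mat_diag n f * transpose_mat Q"

lemma orthogonal_matrix_mult:
  fixes P Q :: "'a :: comm_semiring_1 mat"
  assumes "orthogonal_matrix n P" "orthogonal_matrix n Q"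
  shows "orthogonal_matrix n (P * Q)"
proof -
  have P: "P \<in> carrier_mat n n" "transpose_mat P \<in> carrier_mat n n"
    and Q: "Q \<in> carrier_mat n n" "transpose_mat Q \<in> carrier_mat n n"
    and PQ: "transpose_mat P * P = 1\<^sub>m n" "P * transpose_mat P = 1\<^sub>m n"
      "transpose_mat Q * Q = 1\<^sub>m n" "Q * transpose_mat Q = 1\<^sub>m n"
    using assms by (auto simp: orthogonal_matrix_def)
  have t: "transpose_mat (P * Q) = transpose_mat Q * transpose_mat P"
    using P Q by (intro transpose_mult)
  have "transpose_mat Q * transpose_mat P * (P * Q) =
      transpose_mat Q * ((transpose_mat P * P) * Q)"
    using P Q by (simp add: assoc_mult_mat[of _ n n _ n _ n])
  moreover have "P * Q * (transpose_mat Q * transpose_mat P) =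
      P * ((Q * transpose_mat Q) * transpose_mat P)"
    using P Q by (simp add: assoc_mult_mat[of _ n n _ n _ n])
  ultimately show ?thesis
    using P Q by (simp add: orthogonal_matrix_def t PQ)
qed

lemma spectral_mat_mult_orthogonal:
  fixes P Q :: "'a :: comm_semiring_1 mat"
  assumes P: "P \<in> carrier_mat n n" and Q: "Q \<in> carrier_mat n n"
  shows "spectral_mat n (P * Q) f = P * spectral_mat n Q f * transpose_mat P"
proof -
  have "transpose_mat (P * Q) = transpose_mat Q * transpose_mat P"
    using P Q by (intro transpose_mult)
  moreover have D: "mat_diag n f \<in> carrier_mat n n" by simp
  moreover have "transpose_mat P \<in> carrier_mat n n" "transpose_mat Q \<in> carrier_mat n n"
    using P Q by auto
  ultimately show ?thesis
    using P Q
    by (simp add: spectral_mat_def assoc_mult_mat[of _ n n _ n _ n] mult_carrier_mat[of _ n n _ n])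
qed

text \<open>Deflation: a unit eigenvector is reflected onto e_0, which splits off a 1 by 1 block,
  and the induction hypothesis diagonalises the remaining symmetric block.\<close>

theorem real_spectral_theorem:
  fixes A :: "real mat"
  assumes "A \<in> carrier_mat n n" "transpose_mat A = A"
  shows "\<exists>Q d. orthogonal_matrix n Q \<and> A = spectral_mat n Q d"
  using assms
proof (induction n arbitrary: A)
  case 0
  have "orthogonal_matrix 0 (1\<^sub>m 0 :: real mat)"
    by (simp add: orthogonal_matrix_def)
  moreover have "A = spectral_mat 0 (1\<^sub>m 0) (\<lambda>_. 0)"
    using 0 by (intro eq_matI) (auto simp: spectral_mat_def)
  ultimately show ?case by blast
next
  case (Suc n)
  let ?N = "Suc n"
  note A = Suc.prems(1)
  obtain k where "eigenvalue A k"
    using symmetric_real_eigenvalue[OF A _ Suc.prems(2)] by blast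
  then obtain u where u: "u \<in> carrier_vec ?N" "u \<noteq> 0\<^sub>v ?N" "A *\<^sub>v u = k \<cdot>\<^sub>v u"
    using A by (auto simp: eigenvalue_def eigenvector_def)
  have uu: "u \<bullet> u > 0"
    using conjugate_square_greater_0_vec[OF u(1)] u(2) by (simp add: conjugate_vec_def vec_eq_iff)
  define v where "v = (1 / sqrt (u \<bullet> u)) \<cdot>\<^sub>v u"
  have v: "v \<in> carrier_vec ?N" using u by (simp add: v_def)
  have "v \<bullet> v = (1 / sqrt (u \<bullet> u)) * (1 / sqrt (u \<bullet> u)) * (u \<bullet> u)"
    using u(1) unfolding v_def by simp
  also have "\<dots> = 1" using uu by (simp add: field_simps)
  finally have vv: "v \<bullet> v = 1" .
  have Av: "A *\<^sub>v v = k \<cdot>\<^sub>v v"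
    using u A unfolding v_def by (simp add: mult_mat_vec smult_smult_assoc mult.commute)
  obtain H where H: "H \<in> carrier_mat ?N ?N" and tH: "transpose_mat H = H"
    and HH: "H * H = 1\<^sub>m ?N" and H0: "col H 0 = v"
    using householder[OF v vv] .
  \<comment> \<open>As \<open>H\<close> sends e_0 to \<open>v\<close> and is an involution, column 0
    of \<open>B\<close> is \<open>k\<close> times e_0; symmetry of \<open>B\<close> then clears row
    0 as well.\<close>
  define B where "B = H * A * H"
  have B: "B \<in> carrier_mat ?N ?N" using H A by (simp add: B_def)
  have tB: "transpose_mat B = B"
    using H A by (simp add: B_def transpose_mult[of _ ?N ?N _ ?N] tH Suc.prems(2)
        assoc_mult_mat[of _ ?N ?N _ ?N _ ?N])
  have "col B 0 = (H * A) *\<^sub>v v"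
    unfolding B_def H0[symmetric] using H A by (intro col_mult2[of _ ?N ?N _ ?N]) auto
  also have "\<dots> = H *\<^sub>v (A *\<^sub>v v)"
    using H A v by (intro assoc_mult_mat_vec)
  also have "\<dots> = k \<cdot>\<^sub>v (H *\<^sub>v v)" using H v by (simp add: Av mult_mat_vec)
  also have "H *\<^sub>v v = col (H * H) 0" by (simp only: col_mult2[OF H H] zero_less_Suc H0)
  also have "\<dots> = unit_vec ?N 0" by (simp add: HH)
  finally have colB: "col B 0 = k \<cdot>\<^sub>v unit_vec ?N 0" .
  have B0: "B $$ (i, 0) = (if i = 0 then k else 0)" if "i < ?N" for i
  proof -
    have "B $$ (i, 0) = col B 0 $ i" using that B by simp
    then show ?thesis unfolding colB using that by simp
  qed
  have symB: "B $$ (i, j) = B $$ (j, i)" if "i < ?N" "j < ?N" for i j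
    using tB B that by (metis carrier_matD index_transpose_mat(1))
  define C where "C = mat n n (\<lambda>(i, j). B $$ (Suc i, Suc j))"
  have C: "C \<in> carrier_mat n n" by (simp add: C_def)
  have "transpose_mat C = C"
    by (rule eq_matI) (auto simp: C_def symB)
  then obtain Q d where Q: "orthogonal_matrix n Q" and CQ: "C = spectral_mat n Q d"
    using Suc.IH[OF C] by blast
  have Qc: "Q \<in> carrier_mat n n" "transpose_mat Q \<in> carrier_mat n n"
    and QQ: "transpose_mat Q * Q = 1\<^sub>m n" "Q * transpose_mat Q = 1\<^sub>m n"
    using Q by (auto simp: orthogonal_matrix_def)
  define R where "R = four_block_mat (1\<^sub>m 1) (0\<^sub>m 1 n) (0\<^sub>m n 1) Q"
  have tR: "transpose_mat R = four_block_mat (1\<^sub>m 1) (0\<^sub>m 1 n) (0\<^sub>m n 1) (transpose_mat Q)"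
    using Qc by (simp add: R_def transpose_four_block_mat[of _ 1 1 _ n _ n])
  have R: "R \<in> carrier_mat ?N ?N" "transpose_mat R \<in> carrier_mat ?N ?N"
    using four_block_carrier_mat[of "1\<^sub>m 1" 1 1 Q n n] Qc by (auto simp: R_def)
  have RR: "transpose_mat R * R = 1\<^sub>m ?N" "R * transpose_mat R = 1\<^sub>m ?N"
    unfolding tR unfolding R_def
    using Qc four_block_one_mat[of 1 n, where 'a = real]
    by (simp_all add: mult_four_block_mat[of _ 1 1 _ n _ n _ _ 1 _ n] QQ)
  have oR: "orthogonal_matrix ?N R" using R RR by (simp add: orthogonal_matrix_def)
  have oH: "orthogonal_matrix ?N H" using H tH HH by (simp add: orthogonal_matrix_def)
  define e where "e = case_nat k d"
  define D1 where "D1 = mat_diag 1 (\<lambda>_. k)"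
  have D1: "D1 \<in> carrier_mat 1 1" unfolding D1_def by (rule mat_diag_dim)
  have De: "mat_diag ?N e = four_block_mat D1 (0\<^sub>m 1 n) (0\<^sub>m n 1) (mat_diag n d)"
    by (rule eq_matI) (auto simp: mat_diag_def e_def D1_def split: nat.splits)
  have QD: "Q * mat_diag n d \<in> carrier_mat n n"
    using Qc mat_diag_dim[of n d] by auto
  have RD: "R * mat_diag ?N e = four_block_mat D1 (0\<^sub>m 1 n) (0\<^sub>m n 1) (Q * mat_diag n d)"
    unfolding R_def De
    by (subst mult_four_block_mat[of _ 1 1 _ n _ n _ _ 1 _ n])
       (use Qc D1 QD in \<open>auto simp del: One_nat_def simp: left_mult_one_mat[of _ 1 1]
          left_mult_zero_mat[OF mat_diag_dim] left_mult_zero_mat[of _ 1] left_mult_zero_mat[of _ 1 1]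
          right_mult_zero_mat[of _ n n] right_mult_zero_mat[of _ 1 1]\<close>)
  have "spectral_mat ?N R e = four_block_mat D1 (0\<^sub>m 1 n) (0\<^sub>m n 1) C"
    unfolding spectral_mat_def[of ?N] CQ tR RD
    by (subst mult_four_block_mat[of _ 1 1 _ n _ n _ _ 1 _ n])
       (use Qc D1 QD in \<open>auto simp del: One_nat_def simp: spectral_mat_def right_mult_one_mat[of _ 1 1]
          right_mult_zero_mat[OF QD]
          mult_carrier_mat[of _ n n _ n]\<close>)
  also have "\<dots> = B"
  proof (rule eq_matI)
    fix i j assume "i < dim_row B" "j < dim_col B"
    then have ij: "i < ?N" "j < ?N" using B by auto
    show "four_block_mat (D1) (0\<^sub>m 1 n) (0\<^sub>m n 1) C $$ (i, j) = B $$ (i, j)"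
      using ij C B0[of i] B0[of j] symB[of 0 j]
      by (cases i; cases j) (auto simp: mat_diag_def C_def D1_def)
  qed (use B C D1 in auto)
  finally have "spectral_mat ?N (H * R) e = H * B * H"
    using spectral_mat_mult_orthogonal[OF H R(1)] tH by simp
  also have "\<dots> = (H * H) * A * (H * H)"
    unfolding B_def using H A by (simp add: assoc_mult_mat[of _ ?N ?N _ ?N _ ?N])
  also have "\<dots> = A" using A by (simp add: HH)
  finally show ?case using orthogonal_matrix_mult[OF oH oR] by metis
qed

section \<open>Calculus of matrices diagonalised by one orthogonal matrix\<close>

lemma spectral_mat_carrier [simp]:
  "Q \<in> carrier_mat n n \<Longrightarrow> spectral_mat n Q f \<in> carrier_mat n n"
  by (simp add: spectral_mat_def mult_carrier_mat[of _ n n _ n])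

lemma spectral_mat_index:
  fixes Q :: "'a :: comm_semiring_1 mat"
  assumes Q: "Q \<in> carrier_mat n n" and "i < n" "j < n"
  shows "spectral_mat n Q f $$ (i, j) = (\<Sum>k<n. Q $$ (i, k) * f k * Q $$ (j, k))"
  using assms unfolding spectral_mat_def mat_diag_mult_right[OF Q]
  by (simp add: scalar_prod_def atLeast0LessThan)

lemma spectral_mat_cong:
  "(\<And>k. k < n \<Longrightarrow> f k = g k) \<Longrightarrow> spectral_mat n Q f = spectral_mat n Q g"
  unfolding spectral_mat_def by (subst eq_matI[of "mat_diag n f" "mat_diag n g"]) (auto simp: mat_diag_def)

lemma spectral_mat_add:
  fixes Q :: "'a :: comm_semiring_1 mat"
  assumes "Q \<in> carrier_mat n n"
  shows "spectral_mat n Q f + spectral_mat n Q g = spectral_mat n Q (\<lambda>k. f k + g k)"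
  using assms carrier_matD[OF spectral_mat_carrier[OF assms]]
  by (intro eq_matI) (simp_all add: spectral_mat_index sum.distrib algebra_simps)

lemma spectral_mat_smult:
  fixes Q :: "'a :: comm_semiring_1 mat"
  assumes "Q \<in> carrier_mat n n"
  shows "c \<cdot>\<^sub>m spectral_mat n Q f = spectral_mat n Q (\<lambda>k. c * f k)"
  using assms carrier_matD[OF spectral_mat_carrier[OF assms]]
  by (intro eq_matI) (simp_all add: spectral_mat_index sum_distrib_left mult_ac)

lemma spectral_mat_zero:
  fixes Q :: "'a :: comm_semiring_1 mat"
  assumes "Q \<in> carrier_mat n n"
  shows "spectral_mat n Q (\<lambda>_. 0) = 0\<^sub>m n n"
  using assms carrier_matD[OF spectral_mat_carrier[OF assms, of "\<lambda>_. 0"]]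
  by (intro eq_matI) (simp_all add: spectral_mat_index)

lemma spectral_mat_mult:
  fixes Q :: "'a :: comm_semiring_1 mat"
  assumes "orthogonal_matrix n Q"
  shows "spectral_mat n Q f * spectral_mat n Q g = spectral_mat n Q (\<lambda>k. f k * g k)"
proof -
  have Q: "Q \<in> carrier_mat n n" "transpose_mat Q \<in> carrier_mat n n"
    and QQ: "transpose_mat Q * Q = 1\<^sub>m n"
    using assms by (auto simp: orthogonal_matrix_def)
  have "spectral_mat n Q f * spectral_mat n Q g =
      Q * (mat_diag n f * ((transpose_mat Q * Q) * (mat_diag n g * transpose_mat Q)))"
    using Q by (simp add: spectral_mat_def assoc_mult_mat[of _ n n _ n _ n] mult_carrier_mat[of _ n n _ n])
  also have "\<dots> = Q * ((mat_diag n f * mat_diag n g) * transpose_mat Q)"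
    using Q by (simp del: mat_diag_diag add: QQ left_mult_one_mat[of _ n n] assoc_mult_mat[of _ n n _ n _ n] mult_carrier_mat[of _ n n _ n])
  also have "\<dots> = spectral_mat n Q (\<lambda>k. f k * g k)"
    using Q by (simp add: spectral_mat_def assoc_mult_mat[of _ n n _ n _ n])
  finally show ?thesis .
qed

lemma spectral_mat_one:
  fixes Q :: "'a :: comm_semiring_1 mat"
  assumes "orthogonal_matrix n Q"
  shows "spectral_mat n Q (\<lambda>_. 1) = 1\<^sub>m n"
  using assms by (auto simp: spectral_mat_def orthogonal_matrix_def right_mult_one_mat[of _ n n])

lemma (in comm_semiring_hom) orthogonal_matrix_hom:
  assumes "orthogonal_matrix n Q"
  shows "orthogonal_matrix n (map_mat hom Q)"
proof -
  have Q: "Q \<in> carrier_mat n n" "transpose_mat Q \<in> carrier_mat n n"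
    and QQ: "transpose_mat Q * Q = 1\<^sub>m n" "Q * transpose_mat Q = 1\<^sub>m n"
    using assms by (auto simp: orthogonal_matrix_def)
  have t: "transpose_mat (map_mat hom Q) = map_mat hom (transpose_mat Q)"
    by (rule eq_matI) auto
  show ?thesis
    using Q by (simp add: orthogonal_matrix_def t mat_hom_mult[symmetric, of _ n n _ n] QQ mat_hom_one)
qed

lemma (in comm_semiring_hom) spectral_mat_hom:
  assumes "Q \<in> carrier_mat n n"
  shows "map_mat hom (spectral_mat n Q f) = spectral_mat n (map_mat hom Q) (\<lambda>k. hom (f k))"
  using assms carrier_matD[OF spectral_mat_carrier[OF assms]]
    carrier_matD[OF spectral_mat_carrier[of "map_mat hom Q" n "\<lambda>k. hom (f k)"]]
  by (intro eq_matI) (simp_all add: spectral_mat_index hom_distribs)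

lemma eigenvalue_spectral_mat:
  fixes Q :: "'a :: field mat"
  assumes "orthogonal_matrix n Q"
  shows "eigenvalue (spectral_mat n Q f) x \<longleftrightarrow> (\<exists>k<n. x = f k)"
proof -
  have Q: "Q \<in> carrier_mat n n" "transpose_mat Q * Q = 1\<^sub>m n" "Q * transpose_mat Q = 1\<^sub>m n"
    using assms by (auto simp: orthogonal_matrix_def)
  have "similar_mat (spectral_mat n Q f) (mat_diag n f)"
    using Q by (intro similar_matI[of _ _ Q "transpose_mat Q" n]) (auto simp: spectral_mat_def)
  then have "char_poly (spectral_mat n Q f) = char_poly (mat_diag n f)"
    by (rule char_poly_similar)
  also have "\<dots> = (\<Prod>a\<leftarrow>diag_mat (mat_diag n f). [:- a, 1:])"
    by (rule char_poly_upper_triangular[of _ n]) (auto simp: upper_triangular_def mat_diag_def)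
  also have "diag_mat (mat_diag n f) = map f [0..<n]"
    by (auto simp: diag_mat_def mat_diag_def)
  finally have "poly (char_poly (spectral_mat n Q f)) x = 0 \<longleftrightarrow> (\<exists>k<n. x = f k)"
    by (auto simp: poly_prod_list prod_list_zero_iff o_def)
  then show ?thesis
    using eigenvalue_root_char_poly[OF spectral_mat_carrier[OF Q(1)]] by simp
qed

section \<open>Gram matrices and singular values\<close>

lemma mat_adjoint_index:
  "i < dim_col M \<Longrightarrow> j < dim_row M \<Longrightarrow> mat_adjoint M $$ (i, j) = conjugate (M $$ (j, i))"
  by (simp add: mat_adjoint_def mat_of_rows_def)

lemma mat_adjoint_dim [simp]:
  "dim_row (mat_adjoint M) = dim_col M" "dim_col (mat_adjoint M) = dim_row M"
  by (simp_all add: mat_adjoint_def)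

text \<open>The transfer matrix stacks a position block on a velocity block; its squared singular
  values are read off the sum of the two Gram matrices.\<close>

lemma mat_adjoint_append_rows_mult:
  fixes A B :: "complex mat"
  assumes A: "A \<in> carrier_mat p n" and B: "B \<in> carrier_mat q n"
  shows "mat_adjoint (A @\<^sub>r B) * (A @\<^sub>r B) = mat_adjoint A * A + mat_adjoint B * B"
proof (rule eq_matI)
  fix i j
  assume "i < dim_row (mat_adjoint A * A + mat_adjoint B * B)"
    "j < dim_col (mat_adjoint A * A + mat_adjoint B * B)"
  then have ij: "i < n" "j < n" using A B by auto
  have split: "(\<Sum>k<p + q. f k) = (\<Sum>k<p. f k) + (\<Sum>k<q. f (p + k))" for f :: "nat \<Rightarrow> complex"
    by (induction q) (simp_all add: add.assoc)
  have "(mat_adjoint (A @\<^sub>r B) * (A @\<^sub>r B)) $$ (i, j) =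
      (\<Sum>k<p + q. cnj ((A @\<^sub>r B) $$ (k, i)) * (A @\<^sub>r B) $$ (k, j))"
    using ij A B by (simp add: scalar_prod_def atLeast0LessThan mat_adjoint_index append_rows_def)
  also have "\<dots> = (\<Sum>k<p. cnj (A $$ (k, i)) * A $$ (k, j)) + (\<Sum>k<q. cnj (B $$ (k, i)) * B $$ (k, j))"
    unfolding split using ij A B by (simp add: append_rows_def)
  finally show "(mat_adjoint (A @\<^sub>r B) * (A @\<^sub>r B)) $$ (i, j) =
      (mat_adjoint A * A + mat_adjoint B * B) $$ (i, j)"
    using ij A B by (simp add: scalar_prod_def atLeast0LessThan mat_adjoint_index)
qed (use A B in \<open>auto simp: append_rows_def\<close>)

lemma mat_adjoint_spectral_mat:
  fixes Q :: "real mat"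
  assumes "Q \<in> carrier_mat n n"
  shows "mat_adjoint (spectral_mat n (map_mat complex_of_real Q) f) =
    spectral_mat n (map_mat complex_of_real Q) (\<lambda>k. cnj (f k))"
  using assms carrier_matD[OF spectral_mat_carrier[of "map_mat complex_of_real Q" n f]]
    carrier_matD[OF spectral_mat_carrier[of "map_mat complex_of_real Q" n "\<lambda>k. cnj (f k)"]]
  by (intro eq_matI)
     (simp_all add: mat_adjoint_index spectral_mat_index mult_ac)

lemma sigma_max_spectral:
  fixes M Q :: "complex mat" and e :: "nat \<Rightarrow> real"
  assumes Q: "orthogonal_matrix n Q" and n: "0 < n"
    and M: "mat_adjoint M * M = spectral_mat n Q (\<lambda>k. of_real (e k))" and e: "\<And>k. k < n \<Longrightarrow> 0 \<le> e k"
  shows "sigma_max M = Max ((\<lambda>k. sqrt (e k)) ` {..<n})"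
proof -
  have "\<sigma>\<^sup>2 = e k \<longleftrightarrow> \<sigma> = sqrt (e k)" if "0 \<le> \<sigma>" "k < n" for \<sigma> k
    using that e[of k] by (auto simp: real_sqrt_unique[symmetric])
  then have "singular_values M = (\<lambda>k. sqrt (e k)) ` {..<n}"
    unfolding singular_values_def M eigenvalue_spectral_mat[OF Q] of_real_eq_iff
    using e by auto
  then show ?thesis by (simp add: sigma_max_def)
qed

section \<open>Rational functions and transfer matrices\<close>

text \<open>The representing fraction need not be reduced, so values can be computed from any
  representation whose denominator does not vanish at \<open>z\<close>.\<close>

definition has_value :: "complex poly fract \<Rightarrow> complex \<Rightarrow> complex \<Rightarrow> bool" where
  "has_value r z w \<longleftrightarrow> (\<exists>p q. poly q z \<noteq> 0 \<and> r = to_fract p / to_fract q \<and> w = poly p z / poly q z)"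

lemma has_value_to_fract: "has_value (to_fract p) z (poly p z)"
  unfolding has_value_def by (rule exI[of _ p], rule exI[of _ 1]) simp

lemma has_value_divide:
  "poly q z \<noteq> 0 \<Longrightarrow> has_value (to_fract p / to_fract q) z (poly p z / poly q z)"
  unfolding has_value_def by blast

lemma has_value_zero: "has_value 0 z 0"
  using has_value_to_fract[of 0 z] by simp

lemma has_value_add:
  assumes "has_value r z v" "has_value s z w"
  shows "has_value (r + s) z (v + w)"
proof -
  obtain p q p' q' where *: "poly q z \<noteq> 0" "r = to_fract p / to_fract q" "v = poly p z / poly q z"
    "poly q' z \<noteq> 0" "s = to_fract p' / to_fract q'" "w = poly p' z / poly q' z"
    using assms unfolding has_value_def by blast
  then have "q \<noteq> 0" "q' \<noteq> 0" by auto
  then have "r + s = to_fract (p * q' + p' * q) / to_fract (q * q')"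
    using * by (simp add: add_frac_eq)
  moreover have "v + w = poly (p * q' + p' * q) z / poly (q * q') z"
    using * by (simp add: add_frac_eq)
  ultimately show ?thesis
    using * has_value_divide[of "q * q'" z "p * q' + p' * q"] by simp
qed

lemma has_value_mult:
  assumes "has_value r z v" "has_value s z w"
  shows "has_value (r * s) z (v * w)"
proof -
  obtain p q p' q' where *: "poly q z \<noteq> 0" "r = to_fract p / to_fract q" "v = poly p z / poly q z"
    "poly q' z \<noteq> 0" "s = to_fract p' / to_fract q'" "w = poly p' z / poly q' z"
    using assms unfolding has_value_def by blast
  then show ?thesis
    using has_value_divide[of "q * q'" z "p * p'"] by simp
qed

lemma has_value_sum:
  assumes "\<And>k. k \<in> A \<Longrightarrow> has_value (f k) z (g k)"
  shows "has_value (\<Sum>k\<in>A. f k) z (\<Sum>k\<in>A. g k)"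
  using assms
  by (induction A rule: infinite_finite_induct) (simp_all add: has_value_zero has_value_add)

text \<open>The fraction p / q differs from the reduced one by a common factor \<open>d\<close>.
  Since q(z) is the reduced denominator at z times d(z), both are nonzero, so \<open>d\<close>
  cancels in the value.\<close>

lemma has_value_pole_eval:
  assumes "has_value r z w"
  shows "\<not> fract_pole r z" and "fract_eval r z = w"
proof -
  obtain p q where pq: "poly q z \<noteq> 0" "r = to_fract p / to_fract q" "w = poly p z / poly q z"
    using assms unfolding has_value_def by blast
  then have "q \<noteq> 0" by auto
  have "quot_of_fract r = normalize_quot (p, q)"
    using quot_of_fract_quot_to_fract[of "(p, q)"]
    by (simp add: pq(2) quot_to_fract_def Fract_conv_to_fract)
  moreover obtain d where "p = fst (normalize_quot (p, q)) * d" "q = snd (normalize_quot (p, q)) * d"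
    using normalize_quotE[OF \<open>q \<noteq> 0\<close>, of p] by metis
  ultimately have d: "p = fst (quot_of_fract r) * d" "q = snd (quot_of_fract r) * d"
    by simp_all
  have "poly q z = poly (snd (quot_of_fract r)) z * poly d z"
    by (subst d(2)) simp
  then have nz: "poly (snd (quot_of_fract r)) z \<noteq> 0" "poly d z \<noteq> 0"
    using pq(1) by auto
  have "w = poly (fst (quot_of_fract r) * d) z / poly (snd (quot_of_fract r) * d) z"
    using pq(3) d by simp
  then show "fract_eval r z = w"
    using nz by (simp add: fract_eval_def)
  show "\<not> fract_pole r z" using nz by (simp add: fract_pole_def)
qed

text \<open>Names the entrywise embedding inside \<open>const_mat\<close>, so that it can be
  registered as a ring homomorphism and transport the diagonalisation of the Laplacian.\<close>

definition const_fract :: "real \<Rightarrow> complex poly fract" where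
  "const_fract a = to_fract [:complex_of_real a:]"

interpretation const_fract: comm_ring_hom const_fract
  by unfold_locales (simp_all add: const_fract_def flip: to_fract_add to_fract_mult one_pCons)

lemma const_mat_eq: "const_mat M = map_mat const_fract M"
  by (rule eq_matI) (simp_all add: const_mat_def const_fract_def)

text \<open>Avoids computing an inverse: a solution \<open>Y\<close> of (s I - A) Y = B is
  enough.\<close>

lemma transfer_matrix_eqI:
  assumes A: "A \<in> carrier_mat N N" and B: "B \<in> carrier_mat N m" and C: "C \<in> carrier_mat p N"
    and Y: "Y \<in> carrier_mat N m"
    and eq: "(to_fract [:0, 1:] \<cdot>\<^sub>m 1\<^sub>m N - const_mat A) * Y = const_mat B"
  shows "transfer_matrix A B C = const_mat C * Y"
proof -
  let ?M = "to_fract [:0, 1:] \<cdot>\<^sub>m 1\<^sub>m N - const_mat A"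
  let ?A = "map_mat complex_of_real A"
  interpret to_fract_hom: comm_ring_hom "to_fract :: complex poly \<Rightarrow> _"
    by unfold_locales simp_all
  have M: "?M \<in> carrier_mat N N"
    using A by (intro minus_carrier_mat) (simp add: const_mat_def)
  \<comment> \<open>The determinant of s I - A is the characteristic polynomial, which is monic and
    hence nonzero; so \<open>mat_inverse\<close> does not return \<open>None\<close>.\<close>
  have "?M = map_mat to_fract (char_poly_matrix ?A)"
    using A by (intro eq_matI) (auto simp: const_mat_def char_poly_matrix_def
        simp flip: to_fract_add to_fract_uminus to_fract_diff)
  then have "det ?M = to_fract (char_poly ?A)"
    by (simp add: char_poly_def)
  moreover have "char_poly ?A \<noteq> 0"
    using degree_monic_char_poly[of ?A N] A by auto
  ultimately obtain R where R: "mat_inverse ?M = Some R"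
    using det_non_zero_imp_unit[OF M, of "()"] mat_inverse(1)[OF M, of "()"] by auto
  then have RM: "R * ?M = 1\<^sub>m N" and Rc: "R \<in> carrier_mat N N"
    using mat_inverse(2)[OF M] by auto
  have "R * const_mat B = R * ?M * Y"
    unfolding eq[symmetric] using Rc M Y by (intro assoc_mult_mat[symmetric])
  then have "R * const_mat B = Y" using RM Y by simp
  moreover have "const_mat C * R * const_mat B = const_mat C * (R * const_mat B)"
    using Rc B C by (intro assoc_mult_mat[of _ p N _ N _ m]) (auto simp: const_mat_def)
  ultimately show ?thesis
    using A R by (simp add: transfer_matrix_def)
qed

section \<open>Laplacians of connected graphs\<close>

lemma laplacian_carrier [simp]: "laplacian n A \<in> carrier_mat n n"
  by (simp add: laplacian_def)

lemma laplacian_symmetric: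
  assumes "weighted_graph n A"
  shows "transpose_mat (laplacian n A) = laplacian n A"
  using assms by (intro eq_matI) (auto simp: laplacian_def weighted_graph_def)

lemma laplacian_apply:
  assumes A: "weighted_graph n A" and i: "i < n"
  shows "(\<Sum>j<n. laplacian n A $$ (i, j) * x j) = (\<Sum>j<n. A $$ (i, j) * (x i - x j))"
proof -
  have "(\<Sum>j<n. laplacian n A $$ (i, j) * x j) =
      laplacian n A $$ (i, i) * x i + (\<Sum>j\<in>{..<n} - {i}. laplacian n A $$ (i, j) * x j)"
    using i by (simp add: sum.remove[of _ i])
  also have "\<dots> = (\<Sum>j\<in>{..<n} - {i}. A $$ (i, j) * x i) + (\<Sum>j\<in>{..<n} - {i}. - A $$ (i, j) * x j)"
    using i by (simp add: laplacian_def atLeast0LessThan sum_distrib_right)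
  also have "\<dots> = (\<Sum>j\<in>{..<n} - {i}. A $$ (i, j) * (x i - x j))"
    unfolding sum.distrib[symmetric] by (rule sum.cong) (auto simp: algebra_simps)
  also have "\<dots> = (\<Sum>j<n. A $$ (i, j) * (x i - x j))"
    using i by (simp add: sum.remove[of "{..<n}" i])
  finally show ?thesis .
qed

text \<open>Meant for a single column of the diagonalising matrix. The facts derived here decide how
  the consensus projection acts on that column.\<close>

locale laplacian_eigenvector =
  fixes n :: nat and A :: "real mat" and x :: "nat \<Rightarrow> real" and k :: real
  assumes graph: "weighted_graph n A" and connected: "connected_graph n A"
    and eigen: "\<And>i. i < n \<Longrightarrow> (\<Sum>j<n. laplacian n A $$ (i, j) * x j) = k * x i"
begin

lemma adj_sym: "i < n \<Longrightarrow> j < n \<Longrightarrow> A $$ (i, j) = A $$ (j, i)"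
  and adj_nonneg: "i < n \<Longrightarrow> j < n \<Longrightarrow> 0 \<le> A $$ (i, j)"
  using graph by (auto simp: weighted_graph_def)

text \<open>Exchanging the two indices in the sum for x^T L x and adding both versions completes the
  squares. The factor 2 arises because ordered pairs count each edge twice.\<close>

lemma dirichlet_form:
  "(\<Sum>i<n. \<Sum>j<n. A $$ (i, j) * (x i - x j)\<^sup>2) = 2 * k * (\<Sum>i<n. (x i)\<^sup>2)"
proof -
  let ?q = "\<Sum>i<n. \<Sum>j<n. A $$ (i, j) * (x i - x j) * x i"
  have "?q = (\<Sum>i<n. (\<Sum>j<n. A $$ (i, j) * (x i - x j)) * x i)"
    by (simp only: sum_distrib_right)
  also have "\<dots> = (\<Sum>i<n. k * x i * x i)"
    using eigen laplacian_apply[OF graph] by (intro sum.cong) simp_all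
  finally have q: "?q = k * (\<Sum>i<n. (x i)\<^sup>2)"
    by (simp add: sum_distrib_left power2_eq_square mult.assoc)
  have "?q = (\<Sum>i<n. \<Sum>j<n. A $$ (j, i) * (x j - x i) * x j)"
    by (rule sum.swap)
  also have "\<dots> = (\<Sum>i<n. \<Sum>j<n. A $$ (i, j) * (x j - x i) * x j)"
    by (intro sum.cong refl) (simp add: adj_sym)
  finally have "2 * ?q = ?q + (\<Sum>i<n. \<Sum>j<n. A $$ (i, j) * (x j - x i) * x j)" by simp
  also have "\<dots> = (\<Sum>i<n. \<Sum>j<n. A $$ (i, j) * (x i - x j)\<^sup>2)"
    unfolding sum.distrib[symmetric]
    by (intro sum.cong refl) (simp add: power2_eq_square algebra_simps)
  finally show ?thesis using q by simp
qed

lemma eigenvalue_nonneg: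
  assumes "\<exists>i<n. x i \<noteq> 0"
  shows "0 \<le> k"
proof -
  obtain i where "i < n" "x i \<noteq> 0" using assms by blast
  then have "0 < (\<Sum>i<n. (x i)\<^sup>2)" by (intro sum_pos2[of _ i]) auto
  moreover have "0 \<le> 2 * k * (\<Sum>i<n. (x i)\<^sup>2)"
    unfolding dirichlet_form[symmetric] by (intro sum_nonneg mult_nonneg_nonneg adj_nonneg) auto
  ultimately show ?thesis by (simp add: zero_le_mult_iff)
qed

text \<open>For k = 0 the Dirichlet form vanishes, and so does each of its nonnegative terms. Hence
  \<open>x\<close> agrees across every edge, and along paths everywhere.\<close>

lemma kernel_constant:
  assumes "k = 0" "i < n" "j < n"
  shows "x i = x j"
proof -
  have edge: "x a = x b" if "(a, b) \<in> edges n A" for a b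
  proof -
    have ab: "a < n" "b < n" "0 < A $$ (a, b)" using that by (auto simp: edges_def)
    have "(\<Sum>i<n. \<Sum>j<n. A $$ (i, j) * (x i - x j)\<^sup>2) = 0"
      by (simp add: dirichlet_form assms(1))
    then have "\<forall>i\<in>{..<n}. (\<Sum>j<n. A $$ (i, j) * (x i - x j)\<^sup>2) = 0"
      by (subst (asm) sum_nonneg_eq_0_iff) (auto intro!: sum_nonneg mult_nonneg_nonneg adj_nonneg)
    then have "(\<Sum>j<n. A $$ (a, j) * (x a - x j)\<^sup>2) = 0" using ab by simp
    then have "\<forall>j\<in>{..<n}. A $$ (a, j) * (x a - x j)\<^sup>2 = 0"
      using ab by (subst (asm) sum_nonneg_eq_0_iff) (auto intro!: mult_nonneg_nonneg adj_nonneg)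
    then have "A $$ (a, b) * (x a - x b)\<^sup>2 = 0" using ab by blast
    then show ?thesis using ab by simp
  qed
  have "(i, j) \<in> (edges n A)\<^sup>*"
    using connected assms by (cases "i = j") (auto simp: connected_graph_def)
  then show ?thesis
    by (induction rule: rtrancl_induct) (auto dest: edge)
qed

text \<open>Summing the entries of L x gives an antisymmetric double sum, hence 0; it also equals
  \<open>k\<close> times the sum of \<open>x\<close>.\<close>

lemma sum_zero:
  assumes "k \<noteq> 0"
  shows "(\<Sum>i<n. x i) = 0"
proof -
  let ?s = "\<Sum>i<n. \<Sum>j<n. A $$ (i, j) * (x i - x j)"
  have "?s = (\<Sum>i<n. \<Sum>j<n. A $$ (j, i) * (x j - x i))"
    by (rule sum.swap)
  also have "\<dots> = (\<Sum>i<n. \<Sum>j<n. - (A $$ (i, j) * (x i - x j)))"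
    by (intro sum.cong refl) (simp add: adj_sym algebra_simps)
  also have "\<dots> = - ?s" by (simp add: sum_negf)
  finally have "?s = 0" by simp
  moreover have "?s = k * (\<Sum>i<n. x i)"
    using eigen laplacian_apply[OF graph] by (simp add: sum_distrib_left)
  ultimately show ?thesis using assms by simp
qed

end

section \<open>The consensus projection in the eigenbasis of the Laplacian\<close>

lemma Phi_carrier [simp]: "Phi n \<in> carrier_mat n n"
  by (rule carrier_matI) (simp_all add: Phi_def ones_def)

lemma Phi_index:
  "i < n \<Longrightarrow> j < n \<Longrightarrow> Phi n $$ (i, j) = (if i = j then 1 else 0) - 1 / real n"
  by (simp add: Phi_def ones_def scalar_prod_def)

lemma laplacian_spectral_eigenvector:
  assumes "weighted_graph n A" "connected_graph n A" and Q: "orthogonal_matrix n Q"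
    and L: "laplacian n A = spectral_mat n Q d" and k: "k < n"
  shows "laplacian_eigenvector n A (\<lambda>i. Q $$ (i, k)) (d k)"
proof
  fix i assume i: "i < n"
  have Qc: "Q \<in> carrier_mat n n" "transpose_mat Q \<in> carrier_mat n n"
    and QQ: "transpose_mat Q * Q = 1\<^sub>m n"
    using Q by (auto simp: orthogonal_matrix_def)
  have "laplacian n A * Q = Q * mat_diag n d * (transpose_mat Q * Q)"
    unfolding L spectral_mat_def using Qc
    by (intro assoc_mult_mat[of _ n n _ n _ n]) (auto simp: mult_carrier_mat[of _ n n])
  also have "\<dots> = Q * mat_diag n d"
    using Qc by (simp add: QQ right_mult_one_mat[of _ n n] mult_carrier_mat[of _ n n])
  finally have "(laplacian n A * Q) $$ (i, k) = Q $$ (i, k) * d k"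
    using i k Qc by (simp add: mat_diag_mult_right[OF Qc(1)])
  then show "(\<Sum>j<n. laplacian n A $$ (i, j) * Q $$ (j, k)) = d k * Q $$ (i, k)"
    using i k Qc carrier_matD[OF laplacian_carrier[of n A]]
    by (simp add: scalar_prod_def atLeast0LessThan mult.commute)
qed (use assms in auto)

lemma orthogonal_matrix_col_nonzero:
  fixes Q :: "real mat"
  assumes "orthogonal_matrix n Q" "k < n"
  shows "\<exists>i<n. Q $$ (i, k) \<noteq> 0"
proof (rule ccontr)
  assume "\<not> ?thesis"
  moreover have "Q \<in> carrier_mat n n" using assms by (simp add: orthogonal_matrix_def)
  then have "(transpose_mat Q * Q) $$ (k, k) = (\<Sum>i<n. Q $$ (i, k) * Q $$ (i, k))"
    using assms(2) by (simp add: scalar_prod_def atLeast0LessThan)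
  moreover have "transpose_mat Q * Q = 1\<^sub>m n" using assms by (simp add: orthogonal_matrix_def)
  ultimately show False using assms(2) by simp
qed

text \<open>Subtracting the mean annihilates a constant column and fixes a column with sum 0, and
  each column of \<open>Q\<close> is of one of these kinds. Working column by column, the
  multiplicity of the eigenvalue 0 never has to be determined.\<close>

lemma Phi_spectral:
  assumes graph: "weighted_graph n A" "connected_graph n A" and Q: "orthogonal_matrix n Q"
    and L: "laplacian n A = spectral_mat n Q d"
  shows "Phi n = spectral_mat n Q (\<lambda>k. if d k = 0 then 0 else 1)" (is "_ = spectral_mat n Q ?f")
proof -
  have Qc: "Q \<in> carrier_mat n n" "transpose_mat Q \<in> carrier_mat n n"
    and QQ: "Q * transpose_mat Q = 1\<^sub>m n"
    using Q by (auto simp: orthogonal_matrix_def)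
  have "Phi n * Q = Q * mat_diag n ?f"
  proof (rule eq_matI)
    fix i k assume "i < dim_row (Q * mat_diag n ?f)" "k < dim_col (Q * mat_diag n ?f)"
    then have ik: "i < n" "k < n" using Qc by (auto simp: mat_diag_def)
    interpret laplacian_eigenvector n A "\<lambda>i. Q $$ (i, k)" "d k"
      by (rule laplacian_spectral_eigenvector[OF graph Q L ik(2)])
    have "(Phi n * Q) $$ (i, k) = (\<Sum>j<n. Phi n $$ (i, j) * Q $$ (j, k))"
      using ik Qc carrier_matD[OF Phi_carrier[of n]] by (simp add: scalar_prod_def atLeast0LessThan)
    also have "\<dots> = (\<Sum>j<n. (if i = j then Q $$ (j, k) else 0) - Q $$ (j, k) / real n)"
      using ik by (intro sum.cong) (auto simp: Phi_index algebra_simps)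
    also have "\<dots> = Q $$ (i, k) - (\<Sum>j<n. Q $$ (j, k)) / real n"
      using ik by (simp add: sum_subtractf sum_divide_distrib)
    also have "\<dots> = Q $$ (i, k) * ?f k"
    proof (cases "d k = 0")
      case True
      then have "(\<Sum>j<n. Q $$ (j, k)) = (\<Sum>j<n. Q $$ (i, k))"
        using ik by (intro sum.cong refl kernel_constant) auto
      then show ?thesis using True ik by simp
    next
      case False
      then show ?thesis by (simp add: sum_zero)
    qed
    finally show "(Phi n * Q) $$ (i, k) = (Q * mat_diag n ?f) $$ (i, k)"
      using ik by (simp add: mat_diag_mult_right[OF Qc(1)])
  qed (use Qc carrier_matD[OF Phi_carrier[of n]] in \<open>auto simp: mat_diag_def\<close>)
  then have "Phi n * Q * transpose_mat Q = spectral_mat n Q ?f"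
    by (simp add: spectral_mat_def)
  moreover have "Phi n * Q * transpose_mat Q = Phi n * (Q * transpose_mat Q)"
    using Qc by (intro assoc_mult_mat[of _ n n _ n _ n]) auto
  ultimately show ?thesis by (simp add: QQ right_mult_one_mat[OF Phi_carrier])
qed

text \<open>If all eigenvalues were 0, then \<open>Phi n\<close> would be the zero matrix, but its
  diagonal entries are 1 - 1 / n.\<close>

lemma laplacian_nonzero_eigenvalue_exists:
  assumes graph: "weighted_graph n A" "connected_graph n A" and Q: "orthogonal_matrix n Q"
    and L: "laplacian n A = spectral_mat n Q d" and n: "2 \<le> n"
  shows "\<exists>k<n. d k \<noteq> 0"
proof (rule ccontr)
  assume "\<not> ?thesis"
  then have "spectral_mat n Q (\<lambda>k. if d k = 0 then 0 else 1) = spectral_mat n Q (\<lambda>_. 0)"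
    by (intro spectral_mat_cong) auto
  then have "Phi n $$ (0, 0) = 0"
    using Phi_spectral[OF graph Q L] Q n by (simp add: spectral_mat_index orthogonal_matrix_def)
  then show False using n by (simp add: Phi_index)
qed

lemma min_nonzero_eigenvalue_spectral:
  fixes Q :: "real mat"
  assumes Q: "orthogonal_matrix n Q" and k: "k < n" "d k \<noteq> 0"
  shows "\<exists>m<n. d m \<noteq> 0 \<and> min_nonzero_eigenvalue (spectral_mat n Q d) = d m"
    and "min_nonzero_eigenvalue (spectral_mat n Q d) \<le> d k"
proof -
  let ?S = "{x. eigenvalue (spectral_mat n Q d) x \<and> x \<noteq> 0}"
  have S: "?S = d ` {k. k < n \<and> d k \<noteq> 0}"
    by (auto simp: eigenvalue_spectral_mat[OF Q])
  have fin: "finite ?S" unfolding S by auto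
  have "?S \<noteq> {}" unfolding S using k by auto
  then have "Min ?S \<in> ?S" using fin by (rule Min_in[rotated])
  then show "\<exists>m<n. d m \<noteq> 0 \<and> min_nonzero_eigenvalue (spectral_mat n Q d) = d m"
    unfolding min_nonzero_eigenvalue_def S by auto
  have "d k \<in> ?S" unfolding S using k by auto
  then show "min_nonzero_eigenvalue (spectral_mat n Q d) \<le> d k"
    unfolding min_nonzero_eigenvalue_def using fin by (rule Min_le[rotated])
qed

section \<open>The frequency response of the closed loop\<close>

text \<open>In the Laplace variable velocity is \<open>s\<close> times position, which suggests the
  solution with blocks \<open>sp x\<close> and \<open>s\<close> times \<open>sp x\<close>. The lower
  block equation then says that \<open>x k\<close> is the reciprocal of
  \<open>den k\<close>.\<close>

lemma T2_spectral:
  fixes \<alpha> \<beta> :: real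
  assumes graph: "weighted_graph n A" "connected_graph n A" and Q: "orthogonal_matrix n Q"
    and L: "laplacian n A = spectral_mat n Q d"
  defines "s \<equiv> to_fract [:0, 1:]"
    and "G \<equiv> spectral_mat n (map_mat const_fract Q)
      (\<lambda>k. if d k = 0 then 0 else 1 / to_fract [:complex_of_real (\<alpha> * d k), complex_of_real (\<beta> * d k), 1:])"
  shows "T2 n (laplacian n A) \<alpha> \<beta> = G @\<^sub>r (s \<cdot>\<^sub>m G)"
proof -
  let ?c = const_fract
  let ?Q = "map_mat const_fract Q"
  define sp where "sp = spectral_mat n ?Q"
  define den where "den = (\<lambda>k. to_fract [:complex_of_real (\<alpha> * d k), complex_of_real (\<beta> * d k), 1:])"
  define x where "x = (\<lambda>k. 1 / den k)"
  define J where "J = (\<lambda>k. if d k = 0 then 0 else 1 :: complex poly fract)"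
  have Qc: "Q \<in> carrier_mat n n" using Q by (simp add: orthogonal_matrix_def)
  have oQ: "orthogonal_matrix n ?Q" using Q by (rule const_fract.orthogonal_matrix_hom)
  have Qc': "?Q \<in> carrier_mat n n" using Qc by simp
  have spc: "sp f \<in> carrier_mat n n" for f unfolding sp_def by (rule spectral_mat_carrier[OF Qc'])
  have sp_mult: "sp f * sp g = sp (\<lambda>k. f k * g k)" for f g
    unfolding sp_def by (rule spectral_mat_mult[OF oQ])
  have sp_add: "sp f + sp g = sp (\<lambda>k. f k + g k)" for f g
    unfolding sp_def by (rule spectral_mat_add[OF Qc'])
  have sp_smult: "a \<cdot>\<^sub>m sp f = sp (\<lambda>k. a * f k)" for a f
    unfolding sp_def by (rule spectral_mat_smult[OF Qc'])
  have sp_one: "1\<^sub>m n = sp (\<lambda>_. 1)" unfolding sp_def by (rule spectral_mat_one[OF oQ, symmetric])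
  have sp_zero: "0\<^sub>m n n = sp (\<lambda>_. 0)" unfolding sp_def by (rule spectral_mat_zero[OF Qc', symmetric])
  have Lc: "map_mat ?c (laplacian n A) = sp (\<lambda>k. ?c (d k))"
    unfolding L sp_def by (rule const_fract.spectral_mat_hom[OF Qc])
  have Pc: "map_mat ?c (Phi n) = sp J"
    unfolding Phi_spectral[OF graph Q L] sp_def const_fract.spectral_mat_hom[OF Qc] J_def
    by (rule spectral_mat_cong) simp
  have den: "den k = s * s + (?c \<alpha> + ?c \<beta> * s) * ?c (d k)" for k
    unfolding den_def s_def const_fract_def
    by (simp add: mult_ac flip: to_fract_add to_fract_mult)
  \<comment> \<open>This includes the zero modes, whose denominator is s^2: as rational functions
    they cause no trouble.\<close>
  have den_nz: "den k \<noteq> 0" for k by (simp add: den_def)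

  let ?M = "s \<cdot>\<^sub>m 1\<^sub>m (n + n) - const_mat (state_mat n (laplacian n A) \<alpha> \<beta>)"
  let ?Y = "sp x @\<^sub>r (s \<cdot>\<^sub>m sp x)"
  have state: "const_mat (state_mat n (laplacian n A) \<alpha> \<beta>) = four_block_mat (sp (\<lambda>_. 0)) (sp (\<lambda>_. 1))
      ((- ?c \<alpha>) \<cdot>\<^sub>m sp (\<lambda>k. ?c (d k))) ((- ?c \<beta>) \<cdot>\<^sub>m sp (\<lambda>k. ?c (d k)))"
  proof -
    have smult: "map_mat ?c (a \<cdot>\<^sub>m N) = ?c a \<cdot>\<^sub>m map_mat ?c N" for a N
      by (rule eq_matI) (simp_all add: const_fract.hom_mult)
    have zero: "map_mat ?c (0\<^sub>m n n) = 0\<^sub>m n n" by (rule eq_matI) simp_all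
    show ?thesis
      unfolding sp_zero[symmetric] sp_one[symmetric] Lc[symmetric] const_mat_eq state_mat_def
      by (subst map_four_block_mat[of _ n n _ n _ n])
         (simp_all add: smult zero const_fract.mat_hom_one const_fract.hom_uminus)
  qed
  have M: "?M = four_block_mat (sp (\<lambda>_. s)) (sp (\<lambda>_. - 1)) (sp (\<lambda>k. ?c \<alpha> * ?c (d k)))
      (sp (\<lambda>k. s + ?c \<beta> * ?c (d k)))"
  proof -
    have "sp (\<lambda>_. s) = s \<cdot>\<^sub>m 1\<^sub>m n" "sp (\<lambda>_. - 1) = (- 1) \<cdot>\<^sub>m 1\<^sub>m n"
      "sp (\<lambda>k. ?c \<alpha> * ?c (d k)) = ?c \<alpha> \<cdot>\<^sub>m sp (\<lambda>k. ?c (d k))"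
      "sp (\<lambda>k. s + ?c \<beta> * ?c (d k)) = s \<cdot>\<^sub>m 1\<^sub>m n + ?c \<beta> \<cdot>\<^sub>m sp (\<lambda>k. ?c (d k))"
      by (simp_all add: sp_one sp_smult sp_add)
    then show ?thesis
      unfolding state sp_zero[symmetric] sp_one[symmetric]
      using carrier_matD[OF spc[of "\<lambda>k. ?c (d k)"]] by (intro eq_matI) auto
  qed
  \<comment> \<open>Row stacking is a four-block matrix with right-hand blocks of width 0, so the
    block product rule applies; any two n by 0 matrices are equal.\<close>
  have Y: "?Y = four_block_mat (sp x) (0\<^sub>m n 0) (sp (\<lambda>k. s * x k)) (0\<^sub>m n 0)"
    unfolding append_rows_def sp_smult using carrier_matD[OF spc] by simp
  have block: "four_block_mat (sp a) (sp b) (sp a') (sp b') *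
      four_block_mat (sp f) (0\<^sub>m n 0) (sp g) (0\<^sub>m n 0) =
      four_block_mat (sp (\<lambda>k. a k * f k + b k * g k)) (0\<^sub>m n 0)
        (sp (\<lambda>k. a' k * f k + b' k * g k)) (0\<^sub>m n 0)" for a b a' b' f g
  proof -
    have zero_cols: "M1 = M2" if "M1 \<in> carrier_mat n 0" "M2 \<in> carrier_mat n 0"
      for M1 M2 :: "complex poly fract mat"
      using that by (intro eq_matI) auto
    have "four_block_mat (sp a) (sp b) (sp a') (sp b') *
        four_block_mat (sp f) (0\<^sub>m n 0) (sp g) (0\<^sub>m n 0) =
        four_block_mat (sp a * sp f + sp b * sp g) (sp a * 0\<^sub>m n 0 + sp b * 0\<^sub>m n 0)
          (sp a' * sp f + sp b' * sp g) (sp a' * 0\<^sub>m n 0 + sp b' * 0\<^sub>m n 0)"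
      by (rule mult_four_block_mat[of _ n n _ n _ n _ _ n _ 0]) (simp_all add: spc)
    also have "\<dots> = four_block_mat (sp (\<lambda>k. a k * f k + b k * g k)) (0\<^sub>m n 0)
        (sp (\<lambda>k. a' k * f k + b' k * g k)) (0\<^sub>m n 0)"
      unfolding sp_mult sp_add
      by (intro cong_four_block_mat refl; intro zero_cols) (auto intro!: add_carrier_mat mult_carrier_mat[OF spc])
    finally show ?thesis .
  qed
  have "?M * ?Y = four_block_mat (sp (\<lambda>_. 0)) (0\<^sub>m n 0) (sp (\<lambda>_. 1)) (0\<^sub>m n 0)"
  proof -
    have "?c \<alpha> * ?c (d k) * x k + (s + ?c \<beta> * ?c (d k)) * (s * x k) = 1" for k
    proof -
      have "?c \<alpha> * ?c (d k) * x k + (s + ?c \<beta> * ?c (d k)) * (s * x k) = den k * x k"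
        unfolding den by (simp add: algebra_simps)
      then show ?thesis using den_nz by (simp add: x_def)
    qed
    then show ?thesis unfolding M Y block by simp
  qed
  also have "\<dots> = const_mat (input_mat n)"
    unfolding sp_zero[symmetric] sp_one[symmetric] const_mat_eq input_mat_def append_rows_def
    by (intro eq_matI) auto
  finally have MY: "?M * ?Y = const_mat (input_mat n)" .
  have "T2 n (laplacian n A) \<alpha> \<beta> = const_mat (output_mat n) * ?Y"
    unfolding T2_def
  proof (rule transfer_matrix_eqI)
    show "state_mat n (laplacian n A) \<alpha> \<beta> \<in> carrier_mat (n + n) (n + n)"
      using laplacian_carrier[of n A] by (simp add: state_mat_def)
    show "input_mat n \<in> carrier_mat (n + n) n"
      by (simp add: input_mat_def)
    show "output_mat n \<in> carrier_mat (n + n) (n + n)"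
      by (simp add: output_mat_def)
    show "?Y \<in> carrier_mat (n + n) n"
      by (simp add: spc)
  qed (use MY s_def in simp)
  also have "const_mat (output_mat n) = four_block_mat (sp J) (sp (\<lambda>_. 0)) (sp (\<lambda>_. 0)) (sp J)"
    unfolding sp_zero[symmetric] Pc[symmetric] const_mat_eq output_mat_def
    using carrier_matD[OF Phi_carrier[of n]] by (intro eq_matI) auto
  also have "\<dots> * ?Y = four_block_mat (sp (\<lambda>k. J k * x k)) (0\<^sub>m n 0) (sp (\<lambda>k. J k * (s * x k))) (0\<^sub>m n 0)"
    unfolding Y block by simp
  \<comment> \<open>The zeros of \<open>J\<close> remove the terms 1 / s^2 before anything is
    evaluated.\<close>
  also have "sp (\<lambda>k. J k * x k) = G"
    unfolding G_def sp_def J_def x_def den_def by (rule spectral_mat_cong) simp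
  also have "sp (\<lambda>k. J k * (s * x k)) = s \<cdot>\<^sub>m sp (\<lambda>k. J k * x k)"
    unfolding sp_smult by (simp add: mult_ac)
  also have "sp (\<lambda>k. J k * x k) = G"
    unfolding G_def sp_def J_def x_def den_def by (rule spectral_mat_cong) simp
  finally show ?thesis
    using carrier_matD[OF spectral_mat_carrier[OF Qc']] by (simp add: append_rows_def G_def)
qed

text \<open>A squared singular value at frequency \<upsilon>. The value 0 for k = 0 reflects the
  output projection; the fraction itself would be (1 + \<upsilon>^2) / \<upsilon>^4.\<close>

definition mode_gain :: "real \<Rightarrow> real \<Rightarrow> real \<Rightarrow> real \<Rightarrow> real" where
  "mode_gain \<alpha> \<beta> k \<upsilon> = (if k = 0 then 0 else (1 + \<upsilon>\<^sup>2) / ((\<alpha> * k - \<upsilon>\<^sup>2)\<^sup>2 + (\<beta> * k * \<upsilon>)\<^sup>2))"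

lemma T2_frequency_response:
  fixes \<alpha> \<beta> \<upsilon> :: real
  assumes n: "0 < n" and graph: "weighted_graph n A" "connected_graph n A" and Q: "orthogonal_matrix n Q"
    and L: "laplacian n A = spectral_mat n Q d" and pos: "0 < \<alpha>" "0 < \<beta>"
  defines "T \<equiv> T2 n (laplacian n A) \<alpha> \<beta>" and "z \<equiv> \<i> * complex_of_real \<upsilon>"
  shows "\<not> (\<exists>i<dim_row T. \<exists>j<dim_col T. fract_pole (T $$ (i, j)) z)"
    and "sigma_max (map_mat (\<lambda>r. fract_eval r z) T) =
      Max ((\<lambda>k. sqrt (mode_gain \<alpha> \<beta> (d k) \<upsilon>)) ` {..<n})"
proof -
  let ?s = "to_fract [:0, 1:]"
  let ?Q = "map_mat const_fract Q"
  let ?Qz = "map_mat complex_of_real Q"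
  let ?p = "\<lambda>k. [:complex_of_real (\<alpha> * d k), complex_of_real (\<beta> * d k), 1:]"
  define g where "g = (\<lambda>k. if d k = 0 then 0 else 1 / to_fract (?p k))"
  define \<gamma> where "\<gamma> = (\<lambda>k. if d k = 0 then 0 else 1 / poly (?p k) z)"
  define G where "G = spectral_mat n ?Q g"
  define Gz where "Gz = spectral_mat n ?Qz \<gamma>"
  have Qc: "Q \<in> carrier_mat n n" "?Q \<in> carrier_mat n n" "?Qz \<in> carrier_mat n n"
    using Q by (simp_all add: orthogonal_matrix_def)
  have T: "T = G @\<^sub>r (?s \<cdot>\<^sub>m G)"
    unfolding T_def G_def g_def by (rule T2_spectral[OF graph Q L])
  have Gc: "G \<in> carrier_mat n n" "Gz \<in> carrier_mat n n"
    unfolding G_def Gz_def by (rule spectral_mat_carrier[OF Qc(2)] spectral_mat_carrier[OF Qc(3)])+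
  have p: "poly (?p k) z = Complex (\<alpha> * d k - \<upsilon>\<^sup>2) (\<beta> * d k * \<upsilon>)" for k
    by (simp add: z_def complex_eq_iff power2_eq_square)
  \<comment> \<open>The imaginary part vanishes only at \<upsilon> = 0, where the real part is
    \<open>\<alpha> * d k\<close>.\<close>
  have nz: "poly (?p k) z \<noteq> 0" if "d k \<noteq> 0" for k
    unfolding p using that pos by (cases "\<upsilon> = 0") (auto simp: complex_eq_iff)
  have g: "has_value (g k) z (\<gamma> k)" for k
    using has_value_divide[of "?p k" z 1] nz[of k] by (auto simp: g_def \<gamma>_def has_value_zero)
  have c: "has_value (const_fract a) z (of_real a)" for a
    using has_value_to_fract[of "[:of_real a:]" z] by (simp add: const_fract_def)
  have G: "has_value (G $$ (i, j)) z (Gz $$ (i, j))" if "i < n" "j < n" for i j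
    unfolding G_def Gz_def spectral_mat_index[OF Qc(2) that] spectral_mat_index[OF Qc(3) that]
    using that Qc by (intro has_value_sum has_value_mult g) (auto intro: c)
  have s: "has_value ?s z z" using has_value_to_fract[of "[:0, 1:]" z] by simp
  define Tz where "Tz = Gz @\<^sub>r (z \<cdot>\<^sub>m Gz)"
  have dims: "dim_row T = n + n" "dim_col T = n" "dim_row Tz = n + n" "dim_col Tz = n"
    using Gc by (simp_all add: T Tz_def append_rows_def)
  have T_value: "has_value (T $$ (i, j)) z (Tz $$ (i, j))" if "i < n + n" "j < n" for i j
    using that Gc by (auto simp: T Tz_def append_rows_def intro: G has_value_mult[OF s G])
  then show "\<not> (\<exists>i<dim_row T. \<exists>j<dim_col T. fract_pole (T $$ (i, j)) z)"
    unfolding dims using has_value_pole_eval(1) by blast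
  have "map_mat (\<lambda>r. fract_eval r z) T = Tz"
    using T_value has_value_pole_eval(2) by (intro eq_matI) (auto simp: dims)
  moreover have "sigma_max Tz = Max ((\<lambda>k. sqrt (mode_gain \<alpha> \<beta> (d k) \<upsilon>)) ` {..<n})"
  proof (rule sigma_max_spectral)
    show oQ: "orthogonal_matrix n ?Qz" by (rule of_real_hom.orthogonal_matrix_hom[OF Q])
    have zG: "z \<cdot>\<^sub>m Gz = spectral_mat n ?Qz (\<lambda>k. z * \<gamma> k)"
      unfolding Gz_def by (rule spectral_mat_smult[OF Qc(3)])
    have "mat_adjoint Tz * Tz = mat_adjoint Gz * Gz + mat_adjoint (z \<cdot>\<^sub>m Gz) * (z \<cdot>\<^sub>m Gz)"
      unfolding Tz_def using Gc by (intro mat_adjoint_append_rows_mult) auto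
    also have "\<dots> = spectral_mat n ?Qz (\<lambda>k. cnj (\<gamma> k) * \<gamma> k + cnj (z * \<gamma> k) * (z * \<gamma> k))"
      unfolding zG unfolding Gz_def mat_adjoint_spectral_mat[OF Qc(1)]
        spectral_mat_mult[OF oQ] spectral_mat_add[OF Qc(3)] ..
    also have "\<dots> = spectral_mat n ?Qz (\<lambda>k. of_real (mode_gain \<alpha> \<beta> (d k) \<upsilon>))"
    proof (rule spectral_mat_cong)
      fix k
      have "cnj w * w = of_real ((cmod w)\<^sup>2)" for w
        by (simp only: complex_norm_square mult.commute)
      then have "cnj (\<gamma> k) * \<gamma> k + cnj (z * \<gamma> k) * (z * \<gamma> k) =
          of_real ((cmod (\<gamma> k))\<^sup>2 + (cmod (z * \<gamma> k))\<^sup>2)"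
        by (simp only: of_real_add)
      also have "(cmod (\<gamma> k))\<^sup>2 + (cmod (z * \<gamma> k))\<^sup>2 = mode_gain \<alpha> \<beta> (d k) \<upsilon>"
        unfolding \<gamma>_def p
        by (simp add: mode_gain_def norm_mult norm_divide complex_norm power_mult_distrib
            power_divide z_def add_divide_distrib)
      finally show "cnj (\<gamma> k) * \<gamma> k + cnj (z * \<gamma> k) * (z * \<gamma> k) =
          complex_of_real (mode_gain \<alpha> \<beta> (d k) \<upsilon>)" .
    qed
    finally show "mat_adjoint Tz * Tz =
      spectral_mat n ?Qz (\<lambda>k. of_real (mode_gain \<alpha> \<beta> (d k) \<upsilon>))" .
  qed (use n in \<open>auto simp: mode_gain_def\<close>)
  ultimately show "sigma_max (map_mat (\<lambda>r. fract_eval r z) T) =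
      Max ((\<lambda>k. sqrt (mode_gain \<alpha> \<beta> (d k) \<upsilon>)) ` {..<n})" by simp
qed

section \<open>Optimisation over frequencies and eigenvalues\<close>

text \<open>The minimum over \<open>u = \<upsilon>\<^sup>2 \<ge> 0\<close> of \<open>((a - u)\<^sup>2 + b\<^sup>2 u) / (1 + u)\<close>, where \<open>a = \<alpha>\<lambda>\<close> and
  \<open>b = \<beta>\<lambda>\<close>. In terms of \<open>w = 1 + u \<ge> 1\<close> and \<open>c = (a + 1)\<^sup>2 - b\<^sup>2\<close> the quotient is
  \<open>w + c / w - 2 (a + 1) + b\<^sup>2\<close>, which is minimal at \<open>w = \<surd>c\<close> if \<open>c > 1\<close> and at \<open>w = 1\<close> otherwise.\<close>

definition min_gap :: "real \<Rightarrow> real \<Rightarrow> real" where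
  "min_gap a b = (if b\<^sup>2 < a\<^sup>2 + 2 * a then a\<^sup>2 - (sqrt ((a + 1)\<^sup>2 - b\<^sup>2) - 1)\<^sup>2 else a\<^sup>2)"

lemma min_gap:
  assumes a: "0 < a" and b: "0 < b"
  shows min_gap_pos: "0 < min_gap a b"
    and min_gap_le: "\<And>u. 0 \<le> u \<Longrightarrow> min_gap a b * (1 + u) \<le> (a - u)\<^sup>2 + b\<^sup>2 * u"
    and min_gap_attained: "\<exists>u\<ge>0. min_gap a b * (1 + u) = (a - u)\<^sup>2 + b\<^sup>2 * u"
proof -
  have "0 < min_gap a b \<and> (\<forall>u\<ge>0. min_gap a b * (1 + u) \<le> (a - u)\<^sup>2 + b\<^sup>2 * u) \<and>
    (\<exists>u\<ge>0. min_gap a b * (1 + u) = (a - u)\<^sup>2 + b\<^sup>2 * u)"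
  proof (cases "b\<^sup>2 < a\<^sup>2 + 2 * a")
    case True
    define s where "s = sqrt ((a + 1)\<^sup>2 - b\<^sup>2)"
    have c: "1 < (a + 1)\<^sup>2 - b\<^sup>2" using True by (simp add: power2_eq_square algebra_simps)
    then have s1: "1 < s" by (simp add: s_def)
    have s2: "b\<^sup>2 = (a + 1)\<^sup>2 - s\<^sup>2" using c by (simp add: s_def)
    \<comment> \<open>Damping enters here: for b = 0 one would have s = a + 1 and gap 0, an undamped
      resonance.\<close>
    have "s < a + 1"
      using s2 a b zero_less_power[OF b, of 2] by (intro power2_less_imp_less[of s "a + 1"]) auto
    then have "(s - 1)\<^sup>2 < a\<^sup>2" using s1 by (intro power_strict_mono) auto
    moreover have gap: "min_gap a b = a\<^sup>2 - (s - 1)\<^sup>2" using True by (simp add: min_gap_def s_def)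
    \<comment> \<open>Completing the square yields both the bound and its equality case u = s - 1,
      which is positive because s > 1.\<close>
    moreover have square: "(a - u)\<^sup>2 + b\<^sup>2 * u - min_gap a b * (1 + u) = (1 + u - s)\<^sup>2" for u
      unfolding gap s2 by (simp add: power2_eq_square algebra_simps)
    moreover have "min_gap a b * (1 + u) \<le> (a - u)\<^sup>2 + b\<^sup>2 * u" for u
      using square[of u] zero_le_power2[of "1 + u - s"] by linarith
    moreover have "min_gap a b * (1 + (s - 1)) = (a - (s - 1))\<^sup>2 + b\<^sup>2 * (s - 1)"
      using square[of "s - 1"] by simp
    ultimately show ?thesis using s1 by (intro conjI exI[of _ "s - 1"]) auto
  next
    case False
    then have gap: "min_gap a b = a\<^sup>2" by (simp add: min_gap_def)
    have "a\<^sup>2 * (1 + u) \<le> (a - u)\<^sup>2 + b\<^sup>2 * u" if "0 \<le> u" for u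
    proof -
      \<comment> \<open>Past the threshold both summands are nonnegative, with equality at u = 0:
        the worst frequency is 0.\<close>
      have "(a - u)\<^sup>2 + b\<^sup>2 * u - a\<^sup>2 * (1 + u) = u\<^sup>2 + u * (b\<^sup>2 - (a\<^sup>2 + 2 * a))"
        by (simp add: power2_eq_square algebra_simps)
      moreover have "0 \<le> u * (b\<^sup>2 - (a\<^sup>2 + 2 * a))" using that False by simp
      ultimately show ?thesis using zero_le_power2[of u] by linarith
    qed
    then show ?thesis using a unfolding gap by (intro conjI exI[of _ 0]) auto
  qed
  then show "0 < min_gap a b"
    and "\<And>u. 0 \<le> u \<Longrightarrow> min_gap a b * (1 + u) \<le> (a - u)\<^sup>2 + b\<^sup>2 * u"
    and "\<exists>u\<ge>0. min_gap a b * (1 + u) = (a - u)\<^sup>2 + b\<^sup>2 * u"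
    by blast+
qed

text \<open>Slowing the frequency \<open>\<surd>u\<close> down to \<open>\<surd>(u / t)\<close> compares a mode with the mode
  whose eigenvalue is \<open>t\<close> times smaller; no differentiation in the eigenvalue is needed.\<close>

lemma min_gap_le_scaled:
  assumes a: "0 < a" and b: "0 < b" and t: "1 \<le> t" and u: "0 \<le> u"
  shows "min_gap a b * (1 + u) \<le> (t * a - u)\<^sup>2 + (t * b)\<^sup>2 * u"
proof -
  define w where "w = u / t"
  have w: "u = t * w" "0 \<le> w" using t u by (simp_all add: w_def)
  have "1 + t * w \<le> t * 1 + t * (t * w)"
    using t w mult_right_mono[of 1 t "t * w"] by (simp add: add_mono)
  also have "\<dots> \<le> t * t + t * (t * w)" using t by (simp add: mult_left_mono)
  also have "\<dots> = t\<^sup>2 * (1 + w)" by (simp add: power2_eq_square algebra_simps)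
  finally have "min_gap a b * (1 + t * w) \<le> min_gap a b * (t\<^sup>2 * (1 + w))"
    using min_gap_pos[OF a b] by (intro mult_left_mono) auto
  also have "\<dots> = t\<^sup>2 * (min_gap a b * (1 + w))" by simp
  also have "\<dots> \<le> t\<^sup>2 * ((a - w)\<^sup>2 + b\<^sup>2 * w)"
    using min_gap_le[OF a b w(2)] by (intro mult_left_mono) auto
  \<comment> \<open>At u = t w the damping term of the larger mode carries an additional factor
    \<open>t\<close>, which only enlarges the right-hand side.\<close>
  also have "\<dots> \<le> t\<^sup>2 * ((a - w)\<^sup>2 + b\<^sup>2 * (t * w))"
    using t w mult_right_mono[of 1 t w] by (intro mult_left_mono add_left_mono) auto
  also have "\<dots> = (t * a - t * w)\<^sup>2 + (t * b)\<^sup>2 * (t * w)"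
    by (simp add: power2_eq_square algebra_simps)
  finally show ?thesis by (simp add: w(1))
qed

section \<open>From the scalar minimum to the gains of the modes\<close>

lemma mode_gain_le:
  assumes pos: "0 < \<alpha>" "0 < \<beta>" "0 < m" and k: "k = 0 \<or> m \<le> k"
  shows "mode_gain \<alpha> \<beta> k \<upsilon> \<le> 1 / min_gap (\<alpha> * m) (\<beta> * m)"
proof -
  let ?h = "min_gap (\<alpha> * m) (\<beta> * m)"
  have h: "0 < ?h" using pos by (intro min_gap_pos) auto
  show ?thesis
  proof (cases "k = 0")
    case True
    then show ?thesis using h by (simp add: mode_gain_def)
  next
    case False
    then have "1 \<le> k / m" using k pos by simp
    then have "?h * (1 + \<upsilon>\<^sup>2) \<le> (k / m * (\<alpha> * m) - \<upsilon>\<^sup>2)\<^sup>2 + (k / m * (\<beta> * m))\<^sup>2 * \<upsilon>\<^sup>2"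
      using pos by (intro min_gap_le_scaled) auto
    also have "\<dots> = (\<alpha> * k - \<upsilon>\<^sup>2)\<^sup>2 + (\<beta> * k * \<upsilon>)\<^sup>2"
      using pos by (simp add: power_mult_distrib mult.commute)
    finally have le: "?h * (1 + \<upsilon>\<^sup>2) \<le> (\<alpha> * k - \<upsilon>\<^sup>2)\<^sup>2 + (\<beta> * k * \<upsilon>)\<^sup>2" .
    have "0 < ?h * (1 + \<upsilon>\<^sup>2)"
      using h by (intro mult_pos_pos) (auto simp: add_pos_nonneg)
    with le have "0 < (\<alpha> * k - \<upsilon>\<^sup>2)\<^sup>2 + (\<beta> * k * \<upsilon>)\<^sup>2" by linarith
    then show ?thesis using False h le by (simp add: mode_gain_def field_simps)
  qed
qed

lemma mode_gain_attained:
  assumes pos: "0 < \<alpha>" "0 < \<beta>" "0 < m"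
  shows "\<exists>\<upsilon>. mode_gain \<alpha> \<beta> m \<upsilon> = 1 / min_gap (\<alpha> * m) (\<beta> * m)"
proof -
  let ?h = "min_gap (\<alpha> * m) (\<beta> * m)"
  have ab: "0 < \<alpha> * m" "0 < \<beta> * m" using pos by auto
  obtain u where u: "0 \<le> u" "?h * (1 + u) = (\<alpha> * m - u)\<^sup>2 + (\<beta> * m)\<^sup>2 * u"
    using min_gap_attained[OF ab] by blast
  then have "mode_gain \<alpha> \<beta> m (sqrt u) = (1 + u) / (?h * (1 + u))"
    using pos by (simp add: mode_gain_def power_mult_distrib)
  also have "\<dots> = 1 / ?h" using u(1) by simp
  finally show ?thesis by blast
qed

text \<open>Multiplying the squared threshold condition by m^2 turns it into b^2 < a^2 + 2 a with a
  = \<alpha> m and b = \<beta> m.\<close>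

lemma min_gap_formula:
  assumes pos: "0 < \<alpha>" "0 < \<beta>" "0 < m"
  shows "1 / sqrt (min_gap (\<alpha> * m) (\<beta> * m)) =
    (if \<beta> < sqrt (\<alpha>\<^sup>2 + 2 * \<alpha> / m)
     then 1 / sqrt ((\<alpha> * m)\<^sup>2 - (sqrt ((\<alpha> * m + 1)\<^sup>2 - (\<beta> * m)\<^sup>2) - 1)\<^sup>2)
     else 1 / (\<alpha> * m))"
proof -
  have "\<beta> < sqrt (\<alpha>\<^sup>2 + 2 * \<alpha> / m) \<longleftrightarrow> \<beta>\<^sup>2 < \<alpha>\<^sup>2 + 2 * \<alpha> / m"
    using pos real_sqrt_less_iff[of "\<beta>\<^sup>2" "\<alpha>\<^sup>2 + 2 * \<alpha> / m"] by simp
  also have "\<dots> \<longleftrightarrow> \<beta>\<^sup>2 * m\<^sup>2 < (\<alpha>\<^sup>2 + 2 * \<alpha> / m) * m\<^sup>2"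
    using pos by simp
  also have "\<dots> \<longleftrightarrow> (\<beta> * m)\<^sup>2 < (\<alpha> * m)\<^sup>2 + 2 * (\<alpha> * m)"
    using pos by (simp add: power2_eq_square algebra_simps)
  finally show ?thesis using pos by (simp add: min_gap_def)
qed

theorem theorem2:
  fixes n :: nat and A L :: "real mat" and \<alpha> \<beta> lambda2 :: real
  assumes "2 \<le> n"
    and "weighted_graph n A" and "connected_graph n A"
    and "L = laplacian n A" and "lambda2 = min_nonzero_eigenvalue L"
    and "0 < \<alpha>" and "0 < \<beta>"
  shows "hinf_norm (T2 n L \<alpha> \<beta>) = ereal
    (if \<beta> < sqrt (\<alpha>\<^sup>2 + 2 * \<alpha> / lambda2)
     then 1 / sqrt ((\<alpha> * lambda2)\<^sup>2 -
                    (sqrt ((\<alpha> * lambda2 + 1)\<^sup>2 - (\<beta> * lambda2)\<^sup>2) - 1)\<^sup>2)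
     else 1 / (\<alpha> * lambda2))"
proof -
  note graph = assms(2,3) and pos = assms(6,7)
  obtain Q d where Q: "orthogonal_matrix n Q" and LQ: "laplacian n A = spectral_mat n Q d"
    using real_spectral_theorem[OF laplacian_carrier laplacian_symmetric[OF graph(1)]] by blast
  have d_nonneg: "0 \<le> d k" if "k < n" for k
    using laplacian_eigenvector.eigenvalue_nonneg[OF laplacian_spectral_eigenvector[OF graph Q LQ that]]
      orthogonal_matrix_col_nonzero[OF Q that] by simp
  have lambda2: "lambda2 = min_nonzero_eigenvalue (spectral_mat n Q d)"
    by (simp add: assms(4,5) LQ)
  obtain k0 where k0: "k0 < n" "d k0 \<noteq> 0"
    using laplacian_nonzero_eigenvalue_exists[OF graph Q LQ assms(1)] by blast
  obtain m where m: "m < n" "d m \<noteq> 0" "lambda2 = d m"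
    using min_nonzero_eigenvalue_spectral(1)[of n Q k0 d, OF Q k0] unfolding lambda2 by blast
  \<comment> \<open>The minimum ranges over all nonzero eigenvalues, so its sign rests on the
    Laplacian being positive semidefinite.\<close>
  have lambda2_pos: "0 < lambda2" using m d_nonneg[of m] by simp
  have lambda2_le: "d k = 0 \<or> lambda2 \<le> d k" if "k < n" for k
    using min_nonzero_eigenvalue_spectral(2)[of n Q k d, OF Q that] unfolding lambda2 by blast
  define h where "h = min_gap (\<alpha> * lambda2) (\<beta> * lambda2)"
  let ?\<sigma> = "\<lambda>\<upsilon>. Max ((\<lambda>k. sqrt (mode_gain \<alpha> \<beta> (d k) \<upsilon>)) ` {..<n})"
  have "0 < n" using assms(1) by simp
  note response = T2_frequency_response[OF this graph Q LQ pos]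
  \<comment> \<open>No frequency has a pole, so the infinite branch of the norm never
    occurs.\<close>
  have "hinf_norm (T2 n L \<alpha> \<beta>) = (SUP \<upsilon>. ereal (?\<sigma> \<upsilon>))"
    unfolding hinf_norm_def assms(4) by (simp only: response if_False)
  also have "\<dots> = ereal (1 / sqrt h)"
  proof (rule antisym)
    show "(SUP \<upsilon>. ereal (?\<sigma> \<upsilon>)) \<le> ereal (1 / sqrt h)"
    proof (rule SUP_least)
      fix \<upsilon>
      have "sqrt (mode_gain \<alpha> \<beta> (d k) \<upsilon>) \<le> 1 / sqrt h" if "k < n" for k
        using real_sqrt_le_mono[OF mode_gain_le[OF pos lambda2_pos lambda2_le[OF that], of \<upsilon>]]
        by (simp add: real_sqrt_divide h_def)
      then have "?\<sigma> \<upsilon> \<le> 1 / sqrt h" using \<open>0 < n\<close> by (subst Max_le_iff) auto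
      then show "ereal (?\<sigma> \<upsilon>) \<le> ereal (1 / sqrt h)" by simp
    qed
    \<comment> \<open>The supremum is a maximum: the mode of \<open>lambda2\<close> reaches the
      bound at a real frequency.\<close>
    obtain \<upsilon> where \<upsilon>: "mode_gain \<alpha> \<beta> (d m) \<upsilon> = 1 / h"
      using mode_gain_attained[OF pos lambda2_pos] m(3) by (auto simp: h_def)
    have "1 / sqrt h = sqrt (mode_gain \<alpha> \<beta> (d m) \<upsilon>)" by (simp add: \<upsilon> real_sqrt_divide)
    also have "\<dots> \<le> ?\<sigma> \<upsilon>" using m(1) by (intro Max_ge) auto
    finally show "ereal (1 / sqrt h) \<le> (SUP \<upsilon>. ereal (?\<sigma> \<upsilon>))"
      by (intro SUP_upper2[of \<upsilon>]) auto
  qed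
  finally show ?thesis
    unfolding h_def min_gap_formula[OF pos lambda2_pos] .
qed

end
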